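(* Let $X$ and $Y$ be Hausdorff locally convex topological vector spaces, $\varphi: X\times Y\to\overline{\mathbb{R}}$ a proper convex function, $g_i: X\times Y\to\mathbb{R}$, $i\in I:=\{1,\dots,m\}$, continuous convex functions, $C\subset X\times Y$ a convex set, and, for $j\in J:=\{1,\dots,k\}$, let $h_j(x,y)=\langle(x_j^*,y_j^* ),(x,y)\rangle-\alpha_j$ with $(x_j^*,y_j^* )\in X^*\times Y^*$ and $\alpha_j\in\mathbb{R}$. Let $\mu$ be the optimal value function and $M$ the solution map of the parametric problem $$\min\{\varphi(x,y)\mid (x,y)\in C,\ g_i(x,y)\le 0,\ i\in I,\ h_j(x,y)=0,\ j\in J\}$$ (minimization over $y\in Y$, with parameter $x\in X$). Suppose that $M(\bar x)$ is nonempty for some $\bar x\in{\rm dom}\,\mu$. If $\varphi$ is continuous at a point $(x^0,y^0)\in{\rm int}\,C$ with $g_i(x^0,y^0)<0$ for all $i\in I$ and $h_j(x^0,y^0)=0$ for all $j\in J$, then for any $\bar y\in M(\bar x)$ one has $$\partial^\infty\mu(\bar x)=\bigcup_{(\lambda,\nu)\in\Lambda_0(\bar x,\bar y)}{\rm pr}_{X^*}\Big(\partial\widehat L(\bar x,\bar y,\lambda,\nu)\cap\big(X^*\times\{0\}\big)\Big),$$ where, for every $(\lambda,\nu)\in\Lambda_0(\bar x,\bar y)$, the subdifferential $\partial\widehat L(\bar x,\bar y,\lambda,\nu)$ of the function $\widehat L(\cdot,\cdot,\lambda,\nu)$ at $(\bar x,\bar y)$ is given by $$\partial\widehat L(\bar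 x,\bar y,\lambda,\nu)=\partial^\infty\varphi(\bar x,\bar y)+\sum_{i\in I(\bar x,\bar y)}\lambda_i\partial g_i(\bar x,\bar y)+\sum_{j\in J}\nu_j\partial h_j(\bar x,\bar y)+N((\bar x,\bar y);C).$$
   Context: $\overline{\mathbb{R}}=[-\infty,+\infty]$; $X^*,Y^*$ are the topological duals, and $(X\times Y)^*$ is identified with $X^*\times Y^*$ via $\langle(x^*,y^* ),(x,y)\rangle=\langle x^*,x\rangle+\langle y^*,y\rangle$; ${\rm pr}_{X^*}(x^*,y^* ):=x^*$. A function $f: Z\to\overline{\mathbb{R}}$ is proper if $f>-\infty$ everywhere and ${\rm dom}\,f=\{z\mid f(z)<+\infty\}\neq\emptyset$; convex if its epigraph ${\rm epi}\,f=\{(z,\alpha)\in Z\times\mathbb{R}\mid\alpha\ge f(z)\}$ is convex. "Continuous at a point" means finite-valued and continuous there. For a convex set $\Omega\subset Z$ and $\bar z\in\Omega$, $N(\bar z;\Omega)=\{z^*\in Z^*\mid\langle z^*,z-\bar z\rangle\le 0\ \forall z\in\Omega\}$. For $f$ convex and finite at $\bar z$, the subdifferential is $\partial f(\bar z)=\{z^*\in Z^*\mid\langle z^*,z-\bar z\rangle\le f(z)-f(\bar z)\ \forall z\in Z\}$ and the singular subdifferential is $\partial^\infty f(\bar z)=\{z^*\in Z^*\mid(z^*,0)\in N((\bar z,f(\bar z));{\rm epi}\,f)\}$ (both are $\emptyset$ if $\bar z\notin{\rm dom}\,f$). Sums of sets are Minkowski sums. Let $G(x)=\{y\in Y\mid(x,y)\in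 C,\ g_i(x,y)\le 0\ \forall i\in I,\ h_j(x,y)=0\ \forall j\in J\}$. Then $\mu(x)=\inf\{\varphi(x,y)\mid y\in G(x)\}$ (with $\inf\emptyset=+\infty$), ${\rm dom}\,\mu=\{x\mid\mu(x)<+\infty\}$, and $M(x)=\{y\in G(x)\mid\mu(x)=\varphi(x,y)\}$. For a set $\Omega$, $\iota_\Omega$ is its indicator function ($0$ on $\Omega$, $+\infty$ off $\Omega$). Define $$\widehat L(x,y,\lambda,\nu)=\iota_{{\rm dom}\,\varphi}((x,y))+\sum_{i\in I}\lambda_i g_i(x,y)+\sum_{j\in J}\nu_j h_j(x,y)+\iota_C((x,y)),\quad\lambda\in\mathbb{R}^m,\ \nu\in\mathbb{R}^k.$$ With $I(x,y)=\{i\in I\mid g_i(x,y)=0\}$, $\Lambda_0(x,y)$ is the set of all $(\lambda,\nu)\in\mathbb{R}^m\times\mathbb{R}^k$ with $\lambda_i\ge 0$ for all $i\in I$ and $\lambda_i=0$ for all $i\in I\setminus I(x,y)$. *)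

theory Defs
  imports "HOL-Analysis.Analysis" "HOL-Library.Function_Algebras" "HOL-Library.Set_Algebras"
begin

section \<open>Hausdorff locally convex spaces\<close>

class locally_convex_t2_space = real_vector + topological_ab_group_add + t2_space +
  assumes tendsto_scaleR_Pair:
      "LIM p (nhds (c::real) \<times>\<^sub>F nhds a). fst p *\<^sub>R snd p :> nhds (c *\<^sub>R a)"
    and convex_base_at_0_unfolded:
      "open S \<Longrightarrow> 0 \<in> S \<Longrightarrow> \<exists>U. open U
         \<and> (\<forall>x\<in>U. \<forall>y\<in>U. \<forall>u\<ge>0. \<forall>v\<ge>0. u + v = 1 \<longrightarrow> u *\<^sub>R x + v *\<^sub>R y \<in> U)
         \<and> 0 \<in> U \<and> U \<subseteq> S"

lemma convex_base_at_0:
  fixes S :: "'a::locally_convex_t2_space set"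
  assumes "open S" "0 \<in> S"
  shows "\<exists>U. open U \<and> convex U \<and> 0 \<in> U \<and> U \<subseteq> S"
  using convex_base_at_0_unfolded[OF assms] unfolding convex_def .

instance real_normed_vector \<subseteq> locally_convex_t2_space
proof
  fix c :: real and a :: 'a and S :: "'a set"
  have "((\<lambda>p. fst p *\<^sub>R snd p) \<longlongrightarrow> fst (c, a) *\<^sub>R snd (c, a)) (nhds (c, a))"
    by (intro tendsto_scaleR tendsto_fst tendsto_snd filterlim_ident)
  then show "LIM p (nhds c \<times>\<^sub>F nhds a). fst p *\<^sub>R snd p :> nhds (c *\<^sub>R a)"
    by (simp add: nhds_prod)
  assume "open S" "0 \<in> S"
  then obtain e where "e > 0" "ball 0 e \<subseteq> S"
    by (meson open_contains_ball)
  then show "\<exists>U. open U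
      \<and> (\<forall>x\<in>U. \<forall>y\<in>U. \<forall>u\<ge>0. \<forall>v\<ge>0. u + v = 1 \<longrightarrow> u *\<^sub>R x + v *\<^sub>R y \<in> U)
      \<and> 0 \<in> U \<and> U \<subseteq> S"
    unfolding convex_def[symmetric]
    by (intro exI[of _ "ball 0 e"]) auto
qed

lemma tendsto_scaleR_locally_convex:
  fixes b :: "'a::locally_convex_t2_space"
  assumes "(f \<longlongrightarrow> a) F" "(g \<longlongrightarrow> b) F"
  shows "((\<lambda>x. f x *\<^sub>R g x) \<longlongrightarrow> a *\<^sub>R b) F"
  using filterlim_compose[OF tendsto_scaleR_Pair, of "\<lambda>x. (f x, g x)" a b F] assms
  by (simp add: nhds_prod[symmetric] tendsto_Pair)

instance prod :: (topological_monoid_add, topological_monoid_add) topological_monoid_add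
proof
  fix a b :: "'a \<times> 'b"
  have "((\<lambda>p. (fst (fst p) + fst (snd p), snd (fst p) + snd (snd p))) \<longlongrightarrow>
      (fst (fst (a, b)) + fst (snd (a, b)), snd (fst (a, b)) + snd (snd (a, b)))) (nhds (a, b))"
    by (intro tendsto_Pair tendsto_add tendsto_fst tendsto_snd filterlim_ident)
  then show "LIM x (nhds a \<times>\<^sub>F nhds b). fst x + snd x :> nhds (a + b)"
    by (simp add: nhds_prod[symmetric] plus_prod_def)
qed

instance prod :: (topological_group_add, topological_group_add) topological_group_add
proof
  fix a :: "'a \<times> 'b"
  have "((\<lambda>p. (- fst p, - snd p)) \<longlongrightarrow> (- fst a, - snd a)) (nhds a)"
    by (intro tendsto_Pair tendsto_minus tendsto_fst tendsto_snd filterlim_ident)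
  then show "(uminus \<longlongrightarrow> - a) (nhds a)"
    by (simp add: uminus_prod_def[abs_def])
qed

instance prod :: (topological_ab_group_add, topological_ab_group_add) topological_ab_group_add ..

instance prod :: (locally_convex_t2_space, locally_convex_t2_space) locally_convex_t2_space
proof
  fix c :: real and a :: "'a \<times> 'b" and S :: "('a \<times> 'b) set"
  have "((\<lambda>p. (fst p *\<^sub>R fst (snd p), fst p *\<^sub>R snd (snd p))) \<longlongrightarrow>
      (fst (c, a) *\<^sub>R fst (snd (c, a)), fst (c, a) *\<^sub>R snd (snd (c, a)))) (nhds (c, a))"
    by (intro tendsto_Pair tendsto_scaleR_locally_convex tendsto_fst tendsto_snd filterlim_ident)
  then show "LIM p (nhds c \<times>\<^sub>F nhds a). fst p *\<^sub>R snd p :> nhds (c *\<^sub>R a)"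
    by (simp add: nhds_prod[symmetric] scaleR_prod_def)
  assume "open S" "0 \<in> S"
  then obtain A B where "open A" "open B" "(0::'a) \<in> A" "(0::'b) \<in> B" "A \<times> B \<subseteq> S"
    by (metis open_prod_elim mem_Sigma_iff zero_prod_def)
  moreover obtain U where "open U" "convex U" "0 \<in> U" "U \<subseteq> A"
    using convex_base_at_0 \<open>open A\<close> \<open>0 \<in> A\<close> by blast
  moreover obtain V where "open V" "convex V" "0 \<in> V" "V \<subseteq> B"
    using convex_base_at_0 \<open>open B\<close> \<open>0 \<in> B\<close> by blast
  ultimately show "\<exists>U. open U
      \<and> (\<forall>x\<in>U. \<forall>y\<in>U. \<forall>u\<ge>0. \<forall>v\<ge>0. u + v = 1 \<longrightarrow> u *\<^sub>R x + v *\<^sub>R y \<in> U)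
      \<and> 0 \<in> U \<and> U \<subseteq> S"
    unfolding convex_def[symmetric]
    by (intro exI[of _ "U \<times> V"])
       (auto simp: open_Times convex_Times zero_prod_def)
qed


section \<open>Duality\<close>

text \<open>The topological dual is the set of continuous linear functionals; addition and zero on
  functionals, and Minkowski sums of sets of functionals, come from the pointwise function
  algebra and from the algebra of sets.\<close>

definition top_dual :: "('a::{real_vector,topological_space} \<Rightarrow> real) set" where
  "top_dual = {u. linear u \<and> continuous_on UNIV u}"

text \<open>The identification of \<open>(X \<times> Y)\<^sup>*\<close> with \<open>X\<^sup>* \<times> Y\<^sup>*\<close>, in both directions.\<close>

definition dual_pair :: "('a \<Rightarrow> real) \<Rightarrow> ('b \<Rightarrow> real) \<Rightarrow> 'a \<times> 'b \<Rightarrow> real" where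
  "dual_pair u v = (\<lambda>(x, y). u x + v y)"

definition dual_split :: "('a::zero \<times> 'b::zero \<Rightarrow> real) \<Rightarrow> ('a \<Rightarrow> real) \<times> ('b \<Rightarrow> real)" where
  "dual_split w = (\<lambda>x. w (x, 0), \<lambda>y. w (0, y))"

lemma dual_split_pair:
  assumes "linear u" "linear v"
  shows "dual_split (dual_pair u v) = (u, v)"
  using assms by (simp add: dual_split_def dual_pair_def linear_0)

lemma dual_pair_split:
  assumes "linear w"
  shows "case_prod dual_pair (dual_split w) = w"
proof
  fix p :: "'a \<times> 'b"
  have "w (fst p, 0) + w (0, snd p) = w ((fst p, 0) + (0, snd p))"
    using assms by (simp only: linear_add)
  then show "case_prod dual_pair (dual_split w) p = w p"
    by (simp add: dual_pair_def dual_split_def split_beta)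
qed

lemma dual_pair_in_top_dual:
  fixes u :: "'a::{real_vector,topological_space} \<Rightarrow> real"
    and v :: "'b::{real_vector,topological_space} \<Rightarrow> real"
  assumes "u \<in> top_dual" "v \<in> top_dual"
  shows "dual_pair u v \<in> top_dual"
proof -
  have "linear (dual_pair u v)"
    using assms
    by (intro linearI) (auto simp: dual_pair_def top_dual_def linear_add linear_scale algebra_simps)
  moreover have "continuous_on UNIV (\<lambda>p. u (fst p) + v (snd p))"
    using assms unfolding top_dual_def
    by (auto intro!: continuous_on_add continuous_on_compose2[of UNIV u]
        continuous_on_compose2[of UNIV v] continuous_on_fst continuous_on_snd continuous_on_id)
  ultimately show ?thesis
    by (simp add: top_dual_def dual_pair_def split_beta')
qed

definition scale_set :: "real \<Rightarrow> ('a \<Rightarrow> real) set \<Rightarrow> ('a \<Rightarrow> real) set" where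
  "scale_set c A = (\<lambda>u z. c * u z) ` A"


section \<open>Extended-real-valued convex functions\<close>

definition edom :: "('a \<Rightarrow> ereal) \<Rightarrow> 'a set" where
  "edom f = {z. f z < \<infinity>}"

definition proper_fun :: "('a \<Rightarrow> ereal) \<Rightarrow> bool" where
  "proper_fun f \<longleftrightarrow> (\<forall>z. f z > -\<infinity>) \<and> edom f \<noteq> {}"

definition epi :: "('a \<Rightarrow> ereal) \<Rightarrow> ('a \<times> real) set" where
  "epi f = {(z, \<alpha>). ereal \<alpha> \<ge> f z}"

definition convex_fun :: "('a::real_vector \<Rightarrow> ereal) \<Rightarrow> bool" where
  "convex_fun f \<longleftrightarrow> convex (epi f)"

definition finite_continuous_at :: "('a::t2_space \<Rightarrow> ereal) \<Rightarrow> 'a \<Rightarrow> bool" where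
  "finite_continuous_at f z \<longleftrightarrow> \<bar>f z\<bar> \<noteq> \<infinity> \<and> isCont f z"

definition ind_fun :: "'a set \<Rightarrow> 'a \<Rightarrow> ereal" where
  "ind_fun \<Omega> z = (if z \<in> \<Omega> then 0 else \<infinity>)"

definition normal_cone ::
  "'a::{real_vector,topological_space} \<Rightarrow> 'a set \<Rightarrow> ('a \<Rightarrow> real) set" where
  "normal_cone zbar \<Omega> = {u \<in> top_dual. \<forall>z\<in>\<Omega>. u (z - zbar) \<le> 0}"

text \<open>Both subdifferentials are empty where the function is not finite.\<close>

definition subdiff ::
  "('a::{real_vector,topological_space} \<Rightarrow> ereal) \<Rightarrow> 'a \<Rightarrow> ('a \<Rightarrow> real) set" where
  "subdiff f zbar = (if \<bar>f zbar\<bar> = \<infinity> then {}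
     else {u \<in> top_dual. \<forall>z. ereal (u (z - zbar)) \<le> f z - f zbar})"

definition singular_subdiff ::
  "('a::{real_vector,topological_space} \<Rightarrow> ereal) \<Rightarrow> 'a \<Rightarrow> ('a \<Rightarrow> real) set" where
  "singular_subdiff f zbar = (if \<bar>f zbar\<bar> = \<infinity> then {}
     else {u \<in> top_dual. dual_pair u 0 \<in> normal_cone (zbar, real_of_ereal (f zbar)) (epi f)})"


section \<open>The parametric problem\<close>

text \<open>The inequality and equality constraints are indexed by \<open>{1..m}\<close> and \<open>{1..k}\<close>.\<close>

definition feasible ::
  "('x \<times> 'y) set \<Rightarrow> nat \<Rightarrow> (nat \<Rightarrow> 'x \<times> 'y \<Rightarrow> real) \<Rightarrow> nat \<Rightarrow> (nat \<Rightarrow> 'x \<times> 'y \<Rightarrow> real) \<Rightarrow> 'x \<Rightarrow> 'y set"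
  where
  "feasible C m g k h x =
     {y. (x, y) \<in> C \<and> (\<forall>i\<in>{1..m}. g i (x, y) \<le> 0) \<and> (\<forall>j\<in>{1..k}. h j (x, y) = 0)}"

definition opt_value ::
  "('x \<times> 'y \<Rightarrow> ereal) \<Rightarrow> ('x \<times> 'y) set \<Rightarrow> nat \<Rightarrow> (nat \<Rightarrow> 'x \<times> 'y \<Rightarrow> real) \<Rightarrow>
   nat \<Rightarrow> (nat \<Rightarrow> 'x \<times> 'y \<Rightarrow> real) \<Rightarrow> 'x \<Rightarrow> ereal" where
  "opt_value \<phi> C m g k h x = (INF y\<in>feasible C m g k h x. \<phi> (x, y))"

definition solutions ::
  "('x \<times> 'y \<Rightarrow> ereal) \<Rightarrow> ('x \<times> 'y) set \<Rightarrow> nat \<Rightarrow> (nat \<Rightarrow> 'x \<times> 'y \<Rightarrow> real) \<Rightarrow>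
   nat \<Rightarrow> (nat \<Rightarrow> 'x \<times> 'y \<Rightarrow> real) \<Rightarrow> 'x \<Rightarrow> 'y set" where
  "solutions \<phi> C m g k h x = {y \<in> feasible C m g k h x. opt_value \<phi> C m g k h x = \<phi> (x, y)}"

definition active :: "nat \<Rightarrow> (nat \<Rightarrow> 'z \<Rightarrow> real) \<Rightarrow> 'z \<Rightarrow> nat set" where
  "active m g z = {i \<in> {1..m}. g i z = 0}"

text \<open>Vectors in \<open>\<real>\<^sup>m\<close> and \<open>\<real>\<^sup>k\<close> are extensional functions on the index sets.\<close>

definition Lambda0 ::
  "nat \<Rightarrow> nat \<Rightarrow> (nat \<Rightarrow> 'z \<Rightarrow> real) \<Rightarrow> 'z \<Rightarrow> ((nat \<Rightarrow> real) \<times> (nat \<Rightarrow> real)) set" where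
  "Lambda0 m k g z = {(lam, \<nu>) \<in> ({1..m} \<rightarrow>\<^sub>E UNIV) \<times> ({1..k} \<rightarrow>\<^sub>E UNIV).
     (\<forall>i\<in>{1..m}. lam i \<ge> 0) \<and> (\<forall>i\<in>{1..m} - active m g z. lam i = 0)}"

definition Lhat ::
  "('z \<Rightarrow> ereal) \<Rightarrow> 'z set \<Rightarrow> nat \<Rightarrow> (nat \<Rightarrow> 'z \<Rightarrow> real) \<Rightarrow> nat \<Rightarrow> (nat \<Rightarrow> 'z \<Rightarrow> real) \<Rightarrow>
   (nat \<Rightarrow> real) \<Rightarrow> (nat \<Rightarrow> real) \<Rightarrow> 'z \<Rightarrow> ereal" where
  "Lhat \<phi> C m g k h lam \<nu> z =
     ind_fun (edom \<phi>) z + ereal (\<Sum>i\<in>{1..m}. lam i * g i z)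
       + ereal (\<Sum>j\<in>{1..k}. \<nu> j * h j z) + ind_fun C z"

end

theory Submission
  imports Defs
begin

text \<open>A singular subgradient does not see the values of a function, only its domain: \<open>\<partial>\<^sup>\<infinity>f(a)\<close> is the normal
  cone of \<open>dom f\<close> at \<open>a\<close> whenever \<open>f a\<close> is finite (\<open>singular_subdiff_eq\<close>).
  The domain of \<open>\<mu>\<close> is the projection to \<open>X\<close> of the points of
  \<open>dom \<phi>\<close> that satisfy the constraints.  Hence \<open>u\<close> belongs to \<open>\<partial>\<^sup>\<infinity>\<mu>(xbar)\<close> exactly if the linear
  function \<open>(x, y) \<mapsto> - u (x - xbar)\<close> is nonnegative on those points.  This is a convex program with a
  Slater point, so there are multipliers with
  \<open>u (x - xbar) \<le> \<Sum> \<lambda>\<^sub>i g\<^sub>i + \<Sum> \<nu>\<^sub>j h\<^sub>j\<close> on \<open>dom \<phi> \<inter> C\<close>, which means that \<open>(u, 0)\<close> is a subgradient of the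
  function \<open>Lhat\<close> at \<open>(xbar, ybar)\<close> (\<open>normal_cone_projection\<close>); the converse is immediate from the signs of
  the \<open>\<lambda>\<^sub>i\<close>.

  The multipliers (\<open>lagrange_multipliers\<close>) come one at a time from a comparison of slopes on the
  real line.  For an equality constraint, the interior Slater point makes the constraint function
  change sign or vanish identically; in the first case there are bounds for its multiplier from both
  sides, in the second the multiplier is \<open>0\<close>.

  The formula for the subdifferential of \<open>Lhat\<close> is the Moreau-Rockafellar sum rule
  (\<open>subgradients_sum_rule\<close>): \<open>dom \<phi>\<close> and \<open>C\<close> both contain the Slater point in their interior, and the
  constraint functions are continuous everywhere.  The sum rule follows from a sandwich theorem, which
  applies the Hahn-Banach theorem to a sublinear functional built from the two summands.  The
  resulting functionals are continuous because they are bounded above near the Slater point.  The same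
  rule shows that continuous convex functions have subgradients, so that \<open>0 \<cdot> \<partial>g\<^sub>i\<close> is \<open>{0}\<close> and
  constraints with multiplier zero contribute nothing to the sum.\<close>

section \<open>The Hahn-Banach theorem for sublinear functionals\<close>

text \<open>Positive homogeneity is recorded only as an inequality, which is what constructions by infima
  deliver directly; \<open>sublinear_scale\<close> recovers the equality by also scaling with \<open>1 / r\<close>.\<close>

definition sublinear :: "('a::real_vector \<Rightarrow> real) \<Rightarrow> bool" where
  "sublinear p \<longleftrightarrow> (\<forall>x y. p (x + y) \<le> p x + p y) \<and> (\<forall>r>0. \<forall>x. p (r *\<^sub>R x) \<le> r * p x)"

lemma sublinear_add: "sublinear p \<Longrightarrow> p (x + y) \<le> p x + p y"
  by (simp add: sublinear_def)

lemma sublinear_scale: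
  assumes "sublinear p" "r \<ge> 0"
  shows "p (r *\<^sub>R x) = r * p x"
proof (cases "r = 0")
  case True
  have "p 0 \<le> 2 * p 0"
    using assms(1) unfolding sublinear_def by (metis scaleR_zero_right zero_less_numeral)
  moreover have "p 0 \<le> (1/2) * p 0"
    using assms(1) unfolding sublinear_def
    by (metis scaleR_zero_right zero_less_divide_1_iff zero_less_numeral)
  ultimately show ?thesis
    using True by simp
next
  case False
  with assms have r: "r > 0"
    by simp
  have "p ((1/r) *\<^sub>R (r *\<^sub>R x)) \<le> (1/r) * p (r *\<^sub>R x)"
    using assms(1) r unfolding sublinear_def by (metis zero_less_divide_1_iff)
  then have "r * p x \<le> p (r *\<^sub>R x)"
    using r by (simp add: field_simps)
  moreover have "p (r *\<^sub>R x) \<le> r * p x"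
    using assms(1) r by (simp add: sublinear_def)
  ultimately show ?thesis
    by simp
qed

text \<open>Three constructions below define a functional as a pointwise infimum of sets \<open>S x\<close>: the lower
  bound of a chain, the smaller functional that forces additivity of a minimal one, and the
  perspective of a pair of convex functions.  What makes the infima finite is the same each time: adding
  an element of \<open>S x\<close> to one of \<open>S (- x)\<close> gives a nonnegative number, so \<open>S x\<close> is bounded below.\<close>

lemma Inf_family_sublinear:
  fixes S :: "'a::real_vector \<Rightarrow> real set"
  assumes ne: "\<And>x. S x \<noteq> {}"
    and add: "\<And>x y a b. a \<in> S x \<Longrightarrow> b \<in> S y \<Longrightarrow> \<exists>c\<in>S (x + y). c \<le> a + b"
    and scale: "\<And>r x a. r > 0 \<Longrightarrow> a \<in> S x \<Longrightarrow> \<exists>c\<in>S (r *\<^sub>R x). c \<le> r * a"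
    and zero: "\<And>a. a \<in> S 0 \<Longrightarrow> 0 \<le> a"
  shows "\<And>x. bdd_below (S x)" and "sublinear (\<lambda>x. Inf (S x))"
proof -
  show bdd: "bdd_below (S x)" for x
  proof -
    obtain b where b: "b \<in> S (- x)"
      using ne by blast
    have "- b \<le> a" if "a \<in> S x" for a
      using add[OF that b] zero by force
    then show ?thesis
      by (rule bdd_belowI)
  qed
  have "Inf (S (x + y)) \<le> Inf (S x) + Inf (S y)" for x y
  proof -
    have *: "Inf (S (x + y)) \<le> a + b" if "a \<in> S x" "b \<in> S y" for a b
      using add[OF that] bdd by (meson cInf_lower order_trans)
    have "Inf (S (x + y)) - a \<le> Inf (S y)" if "a \<in> S x" for a
      using ne *[OF that] by (intro cInf_greatest) (auto simp: diff_le_eq add.commute)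
    then have "Inf (S (x + y)) - Inf (S y) \<le> Inf (S x)"
      using ne by (intro cInf_greatest) (auto simp: algebra_simps)
    then show ?thesis
      by simp
  qed
  moreover have "Inf (S (r *\<^sub>R x)) \<le> r * Inf (S x)" if "r > 0" for r x
  proof -
    have "Inf (S (r *\<^sub>R x)) \<le> r * a" if "a \<in> S x" for a
      using scale[OF \<open>r > 0\<close> that] bdd by (meson cInf_lower order_trans)
    then have "Inf (S (r *\<^sub>R x)) / r \<le> Inf (S x)"
      using ne \<open>r > 0\<close> by (intro cInf_greatest) (auto simp: field_simps)
    then show ?thesis
      using \<open>r > 0\<close> by (simp add: field_simps)
  qed
  ultimately show "sublinear (\<lambda>x. Inf (S x))"
    by (simp add: sublinear_def)
qed

text \<open>Zorn's lemma applies because the smaller of two members of a chain can be used for both summands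
  of \<open>x + y\<close>, so that the pointwise infimum of a chain is again sublinear.\<close>

lemma exists_minimal_sublinear:
  fixes p :: "'a::real_vector \<Rightarrow> real"
  assumes "sublinear p"
  obtains q where "sublinear q" "q \<le> p" "\<And>q'. sublinear q' \<Longrightarrow> q' \<le> q \<Longrightarrow> q' = q"
proof -
  define A where "A = {q. sublinear q \<and> q \<le> p}"
  \<comment> \<open>The order is reversed, so that the maximal elements of Zorn's lemma are minimal functionals.\<close>
  define P :: "('a \<Rightarrow> real) \<Rightarrow> ('a \<Rightarrow> real) \<Rightarrow> bool" where "P = (\<lambda>q r. r \<le> q)"
  have "\<exists>m\<in>A. \<forall>a\<in>A. P m a \<longrightarrow> a = m"
  proof (rule predicate_Zorn)
    show "partial_order_on A (relation_of P A)"
      by (rule partial_order_on_relation_ofI) (auto simp: P_def)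
  next
    fix D assume D: "D \<in> Chains (relation_of P A)"
    then have DA: "D \<subseteq> A" and tot: "\<And>q r. q \<in> D \<Longrightarrow> r \<in> D \<Longrightarrow> q \<le> r \<or> r \<le> q"
      by (auto simp: Chains_def relation_of_def P_def)
    show "\<exists>u\<in>A. \<forall>a\<in>D. P a u"
    proof (cases "D = {}")
      case True
      then show ?thesis
        using assms by (auto simp: A_def)
    next
      case False
      define S where "S x = (\<lambda>q. q x) ` D" for x
      have sub: "sublinear q" if "q \<in> D" for q
        using DA that by (auto simp: A_def)
      have add: "\<exists>c\<in>S (x + y). c \<le> a + b" if ab: "a \<in> S x" "b \<in> S y" for x y a b
      proof -
        obtain q r where qr: "q \<in> D" "r \<in> D" "a = q x" "b = r y"
          using ab by (auto simp: S_def)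
        consider "q \<le> r" | "r \<le> q"
          using tot qr by blast
        then show ?thesis
        proof cases
          case 1
          have "q (x + y) \<le> a + b"
            using sublinear_add[OF sub[OF qr(1)], of x y] le_funD[OF 1, of y] qr by simp
          then show ?thesis
            using qr by (auto simp: S_def)
        next
          case 2
          have "r (x + y) \<le> a + b"
            using sublinear_add[OF sub[OF qr(2)], of x y] le_funD[OF 2, of x] qr by simp
          then show ?thesis
            using qr by (auto simp: S_def)
        qed
      qed
      have scale: "\<exists>c\<in>S (r *\<^sub>R x). c \<le> r * a" if "r > 0" "a \<in> S x" for r x a
        using that sub sublinear_scale[of _ r x] by (force simp: S_def)
      have zero: "0 \<le> a" if a: "a \<in> S 0" for a
      proof -
        obtain q where "q \<in> D" "a = q 0"
          using a by (auto simp: S_def)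
        then show ?thesis
          using sublinear_scale[OF sub, of q 0 0] by simp
      qed
      have ne: "S x \<noteq> {}" for x
        using False by (simp add: S_def)
      note inf = Inf_family_sublinear[of S, OF ne add scale zero]
      have below: "(\<lambda>x. Inf (S x)) \<le> q" if "q \<in> D" for q
        using inf(1) that by (auto simp: le_fun_def S_def intro!: cInf_lower)
      moreover have "(\<lambda>x. Inf (S x)) \<le> p"
        using False DA below by (force simp: A_def intro: order_trans)
      ultimately show ?thesis
        using inf(2) by (intro bexI[of _ "\<lambda>x. Inf (S x)"]) (auto simp: A_def P_def)
    qed
  qed
  then obtain m where m: "m \<in> A" "\<And>a. a \<in> A \<Longrightarrow> a \<le> m \<Longrightarrow> a = m"
    by (auto simp: P_def)
  show ?thesis
  proof (rule that[of m])
    show "sublinear m" "m \<le> p"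
      using m(1) by (auto simp: A_def)
    show "q' = m" if "sublinear q'" "q' \<le> m" for q'
      using m that by (auto simp: A_def intro: order_trans)
  qed
qed

text \<open>For a fixed direction \<open>x\<close>, the functional
  \<open>y \<mapsto> inf\<^sub>t (q (y + t x) - t q x)\<close>, with \<open>t\<close> ranging over the nonnegative reals, is sublinear and at
  most \<open>q\<close>, hence equal to \<open>q\<close> by minimality.  Its value is at most the expression at \<open>t = 1\<close>, which is the
  missing inequality \<open>q z + q x \<le> q (z + x)\<close>.\<close>

lemma minimal_sublinear_linear:
  fixes q :: "'a::real_vector \<Rightarrow> real"
  assumes q: "sublinear q" and minimal: "\<And>q'. sublinear q' \<Longrightarrow> q' \<le> q \<Longrightarrow> q' = q"
  shows "linear q"
proof -
  have q0: "q 0 = 0"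
    using sublinear_scale[OF q, of 0 0] by simp
  have additive: "q (z + x) = q z + q x" for z x
  proof -
    define S where "S z = (\<lambda>t. q (z + t *\<^sub>R x) - t * q x) ` {0..}" for z
    have ne: "S y \<noteq> {}" for y
      by (simp add: S_def)
    have add: "\<exists>c\<in>S (y + y'). c \<le> a + b" if ab: "a \<in> S y" "b \<in> S y'" for y y' a b
    proof -
      obtain s t where st: "s \<ge> 0" "t \<ge> 0"
          "a = q (y + s *\<^sub>R x) - s * q x" "b = q (y' + t *\<^sub>R x) - t * q x"
        using ab by (auto simp: S_def)
      have "q ((y + y') + (s + t) *\<^sub>R x) - (s + t) * q x \<le> a + b"
        using sublinear_add[OF q, of "y + s *\<^sub>R x" "y' + t *\<^sub>R x"] st
        by (simp add: algebra_simps)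
      then show ?thesis
        using st by (force simp: S_def)
    qed
    have scale: "\<exists>c\<in>S (r *\<^sub>R y). c \<le> r * a" if r: "r > 0" and a: "a \<in> S y" for r y a
    proof -
      obtain s where s: "s \<ge> 0" "a = q (y + s *\<^sub>R x) - s * q x"
        using a by (auto simp: S_def)
      have eq: "q (r *\<^sub>R y + (r * s) *\<^sub>R x) - (r * s) * q x = r * a"
        using sublinear_scale[OF q, of r "y + s *\<^sub>R x"] r s(1)
        by (simp add: s(2) algebra_simps)
      have "q (r *\<^sub>R y + (r * s) *\<^sub>R x) - (r * s) * q x \<in> S (r *\<^sub>R y)"
        using r s(1) unfolding S_def by (intro image_eqI[of _ _ "r * s"]) auto
      then show ?thesis
        using eq by auto
    qed
    have zero: "0 \<le> a" if "a \<in> S 0" for a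
      using that sublinear_scale[OF q] by (auto simp: S_def)
    note inf = Inf_family_sublinear[of S, OF ne add scale zero]
    have le: "Inf (S y) \<le> q (y + t *\<^sub>R x) - t * q x" if "t \<ge> 0" for t y
      using that inf(1) by (intro cInf_lower) (auto simp: S_def)
    have "(\<lambda>y. Inf (S y)) \<le> q"
      using le[of 0] by (auto simp: le_fun_def)
    then have "(\<lambda>y. Inf (S y)) = q"
      using minimal inf(2) by blast
    then have "q z \<le> q (z + x) - q x"
      using le[of 1 z] by (metis le_numeral_extra(2) linorder_not_less mult_1 not_one_le_zero scaleR_one zero_le_one)
    then show ?thesis
      using sublinear_add[OF q, of z x] by simp
  qed
  have minus: "q (- x) = - q x" for x
    using additive[of x "- x"] q0 by simp
  show ?thesis
  proof (rule linearI)
    show "q (r *\<^sub>R x) = r *\<^sub>R q x" for r x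
      using sublinear_scale[OF q, of r x] sublinear_scale[OF q, of "- r" x] minus[of "r *\<^sub>R x"]
      by (cases "r \<ge> 0") auto
  qed (rule additive)
qed

text \<open>The Hahn-Banach theorem without a prescribed functional on a subspace; the sandwich theorem
  encodes all the data it needs in \<open>p\<close>.\<close>

theorem hahn_banach_sublinear:
  fixes p :: "'a::real_vector \<Rightarrow> real"
  assumes "sublinear p"
  obtains u where "linear u" "\<And>x. u x \<le> p x"
  using exists_minimal_sublinear[OF assms] minimal_sublinear_linear by (metis le_funD)

section \<open>Sandwich theorem and algebraic sum rule\<close>

text \<open>Convexity with weights that are positive but not normalised, the form in which the combinations
  below arise; clearing the denominator keeps the later algebra linear.\<close>

lemma convex_combination_ratio:
  fixes z :: "'a::real_vector"
  assumes "convex_on E f" "x \<in> E" "y \<in> E" "s > 0" "t > 0"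
  defines "v \<equiv> (s / (s + t)) *\<^sub>R x + (t / (s + t)) *\<^sub>R y"
  shows "v \<in> E" "(s + t) *\<^sub>R v = s *\<^sub>R x + t *\<^sub>R y" "(s + t) * f v \<le> s * f x + t * f y"
proof -
  have st: "s / (s + t) + t / (s + t) = 1" "s / (s + t) \<ge> 0" "t / (s + t) \<ge> 0"
    using assms by (auto simp flip: add_divide_distrib)
  show "v \<in> E"
    using assms st unfolding v_def convex_on_def by (meson convexD)
  show "(s + t) *\<^sub>R v = s *\<^sub>R x + t *\<^sub>R y"
    using assms by (simp add: v_def scaleR_add_right)
  have "f v \<le> s / (s + t) * f x + t / (s + t) * f y"
    using assms st unfolding v_def convex_on_def by blast
  then have "(s + t) * f v \<le> (s + t) * (s / (s + t) * f x + t / (s + t) * f y)"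
    using assms by (intro mult_left_mono) auto
  also have "\<dots> = s * f x + t * f y"
    using assms by (simp add: distrib_left)
  finally show "(s + t) * f v \<le> s * f x + t * f y" .
qed

text \<open>Think of the two-point problem of minimising \<open>f1 z1 + f2 z2\<close> subject to \<open>z1 = z2\<close>.  The
  functional \<open>p z = inf {t (f1 z1 + f2 z2) | z = t (z1 - z2), t > 0}\<close> is its value under perturbation of the
  constraint, made homogeneous.  The core condition keeps \<open>p\<close> below \<open>+\<infinity>\<close>, and the
  nonnegativity of \<open>f1 + f2\<close> on \<open>E1 \<inter> E2\<close> keeps it above \<open>-\<infinity>\<close>.  A linear minorant
  of \<open>p\<close> is the multiplier of the constraint.\<close>

lemma convex_sandwich:
  fixes f1 f2 :: "'a::real_vector \<Rightarrow> real"
  assumes f1: "convex_on E1 f1" and f2: "convex_on E2 f2"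
    and core: "\<And>d. \<exists>s>0. z0 + s *\<^sub>R d \<in> E1" and z0: "z0 \<in> E2"
    and nonneg: "\<And>z. z \<in> E1 \<Longrightarrow> z \<in> E2 \<Longrightarrow> 0 \<le> f1 z + f2 z"
  obtains u where "linear u" "\<And>z1 z2. z1 \<in> E1 \<Longrightarrow> z2 \<in> E2 \<Longrightarrow> u (z1 - z2) \<le> f1 z1 + f2 z2"
proof -
  define S where "S z = {t * (f1 z1 + f2 z2) | t z1 z2.
      t > 0 \<and> z1 \<in> E1 \<and> z2 \<in> E2 \<and> z = t *\<^sub>R (z1 - z2)}" for z
  have ne: "S z \<noteq> {}" for z
  proof -
    obtain s where s: "s > 0" "z0 + s *\<^sub>R z \<in> E1"
      using core by blast
    then have "(1/s) * (f1 (z0 + s *\<^sub>R z) + f2 z0) \<in> S z"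
      using z0 unfolding S_def by (intro CollectI exI[of _ "1/s"] exI[of _ "z0 + s *\<^sub>R z"] exI[of _ z0]) auto
    then show ?thesis
      by blast
  qed
  have add: "\<exists>c\<in>S (x + y). c \<le> a + b" if ab: "a \<in> S x" "b \<in> S y" for x y a b
  proof -
    obtain s x1 x2 where x: "s > 0" "x1 \<in> E1" "x2 \<in> E2" "x = s *\<^sub>R (x1 - x2)"
        "a = s * (f1 x1 + f2 x2)"
      using ab(1) by (auto simp: S_def)
    obtain t y1 y2 where y: "t > 0" "y1 \<in> E1" "y2 \<in> E2" "y = t *\<^sub>R (y1 - y2)"
        "b = t * (f1 y1 + f2 y2)"
      using ab(2) by (auto simp: S_def)
    define v where "v = (\<lambda>x y :: 'a. (s / (s + t)) *\<^sub>R x + (t / (s + t)) *\<^sub>R y)"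
    note c1 = convex_combination_ratio[OF f1 x(2) y(2) x(1) y(1), folded v_def]
    note c2 = convex_combination_ratio[OF f2 x(3) y(3) x(1) y(1), folded v_def]
    have "x + y = (s + t) *\<^sub>R (v x1 y1 - v x2 y2)"
      using c1(2) c2(2) x(4) y(4) by (simp add: scaleR_diff_right)
         (simp add: v_def algebra_simps)
    then have "(s + t) * (f1 (v x1 y1) + f2 (v x2 y2)) \<in> S (x + y)"
      using c1(1) c2(1) x(1) y(1) unfolding S_def v_def by (blast intro: add_pos_pos)
    moreover have "(s + t) * (f1 (v x1 y1) + f2 (v x2 y2)) \<le> a + b"
      using c1(3) c2(3) x(5) y(5) by (simp add: distrib_left v_def)
    ultimately show ?thesis
      by blast
  qed
  have scale: "\<exists>c\<in>S (r *\<^sub>R x). c \<le> r * a" if r: "r > 0" and a: "a \<in> S x" for r x a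
  proof -
    obtain s x1 x2 where x: "s > 0" "x1 \<in> E1" "x2 \<in> E2" "x = s *\<^sub>R (x1 - x2)"
        "a = s * (f1 x1 + f2 x2)"
      using a by (auto simp: S_def)
    then have "r * a \<in> S (r *\<^sub>R x)"
      using r unfolding S_def by (intro CollectI exI[of _ "r * s"] exI[of _ x1] exI[of _ x2]) auto
    then show ?thesis
      by blast
  qed
  have zero: "0 \<le> a" if "a \<in> S 0" for a
    using that nonneg by (auto simp: S_def)
  note inf = Inf_family_sublinear[of S, OF ne add scale zero]
  obtain u where u: "linear u" "\<And>x. u x \<le> Inf (S x)"
    using hahn_banach_sublinear[OF inf(2)] by blast
  have "u (z1 - z2) \<le> f1 z1 + f2 z2" if "z1 \<in> E1" "z2 \<in> E2" for z1 z2
  proof -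
    have "f1 z1 + f2 z2 \<in> S (z1 - z2)"
      using that unfolding S_def by (intro CollectI exI[of _ 1] exI[of _ z1] exI[of _ z2]) auto
    then show ?thesis
      using u(2)[of "z1 - z2"] inf(1) by (meson cInf_lower order_trans)
  qed
  then show ?thesis
    using that u(1) by blast
qed

lemma linear_imp_affine_convex_on:
  fixes u :: "'a::real_vector \<Rightarrow> real"
  assumes "linear u" "convex E"
  shows "convex_on E (\<lambda>z. u (z - a) + c)" "convex_on E (\<lambda>z. - u (z - a) + c)"
proof -
  have "s * u x + t * u y - u a = s * (u x - u a) + t * (u y - u a)" if "s + t = 1" for s t x y
  proof -
    have "u a = (s + t) * u a" using that by simp
    then show ?thesis by (simp add: algebra_simps)
  qed
  moreover have "c = s * c + t * c" if "s + t = 1" for s t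
    using that by (metis distrib_right mult_1)
  ultimately show "convex_on E (\<lambda>z. u (z - a) + c)" "convex_on E (\<lambda>z. - u (z - a) + c)"
    using assms unfolding convex_on_def
    by (simp_all add: linear_diff linear_add linear_scale) (smt (verit) distrib_left mult_minus_right)+
qed

text \<open>The Moreau-Rockafellar sum rule without topology: the sandwich theorem for
  \<open>f1 - f1 a\<close> and \<open>f2 - f2 a - w (\<cdot> - a)\<close>, with one of the two points set to \<open>a\<close>.\<close>

lemma convex_sum_rule:
  fixes f1 f2 w :: "'a::real_vector \<Rightarrow> real"
  assumes f1: "convex_on E1 f1" and f2: "convex_on E2 f2" and w: "linear w"
    and core: "\<And>d. \<exists>s>0. z0 + s *\<^sub>R d \<in> E1" and z0: "z0 \<in> E2"
    and a: "a \<in> E1" "a \<in> E2"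
    and le: "\<And>z. z \<in> E1 \<Longrightarrow> z \<in> E2 \<Longrightarrow> w (z - a) \<le> (f1 z - f1 a) + (f2 z - f2 a)"
  obtains u1 u2 where "linear u1" "linear u2" "w = u1 + u2"
    "\<And>z. z \<in> E1 \<Longrightarrow> u1 (z - a) \<le> f1 z - f1 a"
    "\<And>z. z \<in> E2 \<Longrightarrow> u2 (z - a) \<le> f2 z - f2 a"
proof -
  have "convex E1" "convex E2"
    using f1 f2 by (auto simp: convex_on_def)
  then have c1: "convex_on E1 (\<lambda>z. f1 z + - f1 a)"
    using f1 by (intro convex_on_add) (simp_all add: convex_on_const)
  have c2: "convex_on E2 (\<lambda>z. f2 z + (- w (z - a) + - f2 a))"
    using f2 \<open>convex E2\<close> by (intro convex_on_add linear_imp_affine_convex_on w)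
  obtain u where u: "linear u"
    "\<And>z1 z2. z1 \<in> E1 \<Longrightarrow> z2 \<in> E2 \<Longrightarrow>
       u (z1 - z2) \<le> (f1 z1 + - f1 a) + (f2 z2 + (- w (z2 - a) + - f2 a))"
    using convex_sandwich[OF c1 c2 core z0] le by (smt (verit))
  have d: "linear (w - u)"
    using w u(1) by (simp add: linear_compose_sub fun_diff_def)
  have "u (z - a) \<le> f1 z - f1 a" if "z \<in> E1" for z
    using u(2)[OF that a(2)] w by (simp add: linear_0)
  moreover have "(w - u) (z - a) \<le> f2 z - f2 a" if "z \<in> E2" for z
    using u(2)[OF a(1) that] linear_diff[OF u(1), of a z] linear_diff[OF u(1), of z a] by simp
  ultimately show ?thesis
    using that[of u "w - u"] u(1) d by simp
qed

section \<open>Lagrange multipliers under Slater's condition\<close>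

lemma convex_sublevel_set:
  assumes "convex E" "\<And>i. i \<in> I \<Longrightarrow> convex_on E (g i)"
  shows "convex {z \<in> E. \<forall>i\<in>I. g i z \<le> (0::real)}"
proof (rule convexI)
  fix x y and u v :: real
  assume xy: "x \<in> {z \<in> E. \<forall>i\<in>I. g i z \<le> 0}" "y \<in> {z \<in> E. \<forall>i\<in>I. g i z \<le> 0}"
    and uv: "0 \<le> u" "0 \<le> v" "u + v = 1"
  have "g i (u *\<^sub>R x + v *\<^sub>R y) \<le> 0" if "i \<in> I" for i
  proof -
    have "g i (u *\<^sub>R x + v *\<^sub>R y) \<le> u * g i x + v * g i y"
      using assms(2)[OF that] xy uv unfolding convex_on_def by blast
    moreover have "u * g i x \<le> 0" "v * g i y \<le> 0"
      using xy uv that by (auto simp: mult_nonneg_nonpos)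
    ultimately show ?thesis
      by linarith
  qed
  then show "u *\<^sub>R x + v *\<^sub>R y \<in> {z \<in> E. \<forall>i\<in>I. g i z \<le> 0}"
    using xy uv assms(1) by (auto simp: convex_def)
qed

lemma convex_zero_set:
  assumes "convex E" "\<And>j. j \<in> J \<Longrightarrow> convex_on E (h j)" "\<And>j. j \<in> J \<Longrightarrow> convex_on E (\<lambda>z. - h j z)"
  shows "convex {z \<in> E. \<forall>j\<in>J. h j z = (0::real)}"
proof -
  have "{z \<in> E. \<forall>j\<in>J. h j z = 0} =
      {z \<in> E. \<forall>j\<in>J. h j z \<le> 0} \<inter> {z \<in> E. \<forall>j\<in>J. - h j z \<le> 0}"
    by (auto intro: antisym)
  then show ?thesis
    using convex_sublevel_set[of E J h] convex_sublevel_set[of E J "\<lambda>j z. - h j z"] assms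
    by (simp only: convex_Int)
qed

lemma convex_on_weighted_sum:
  fixes g :: "'i \<Rightarrow> 'a::real_vector \<Rightarrow> real"
  assumes "finite I" "convex E" "\<And>i. i \<in> I \<Longrightarrow> lam i \<ge> 0" "\<And>i. i \<in> I \<Longrightarrow> convex_on E (g i)"
  shows "convex_on E (\<lambda>z. \<Sum>i\<in>I. lam i * g i z)"
  using assms
proof (induction I rule: finite_induct)
  case empty
  then show ?case
    by (simp add: convex_on_const)
qed (auto intro!: convex_on_add convex_on_cmul)

lemma real_between:
  fixes L U :: "real set"
  assumes "L \<noteq> {}" "U \<noteq> {}" "\<And>l u. l \<in> L \<Longrightarrow> u \<in> U \<Longrightarrow> l \<le> u"
  obtains c where "\<And>l. l \<in> L \<Longrightarrow> l \<le> c" "\<And>u. u \<in> U \<Longrightarrow> c \<le> u"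
proof (rule that[of "Sup L"])
  obtain u0 where "u0 \<in> U"
    using assms(2) by blast
  then have "bdd_above L"
    using assms(3) by (meson bdd_aboveI)
  show "l \<le> Sup L" if "l \<in> L" for l
    using that \<open>bdd_above L\<close> by (rule cSup_upper)
  show "Sup L \<le> u" if "u \<in> U" for u
    using that assms by (intro cSup_least) auto
qed

lemma multiplier_from_slopes:
  fixes f a :: "'a \<Rightarrow> real"
  assumes "\<And>z. z \<in> E \<Longrightarrow> a z = 0 \<Longrightarrow> 0 \<le> f z"
    and "\<And>z. z \<in> E \<Longrightarrow> a z > 0 \<Longrightarrow> - f z / a z \<le> l"
    and "\<And>z. z \<in> E \<Longrightarrow> a z < 0 \<Longrightarrow> l \<le> f z / (- a z)"
    and "z \<in> E"
  shows "0 \<le> f z + l * a z"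
  using assms(1)[OF assms(4)] assms(2)[OF assms(4)] assms(3)[OF assms(4)]
  by (cases "a z" "0 :: real" rule: linorder_cases) (auto simp: field_simps)

text \<open>The condition on a multiplier \<open>l\<close> at a point \<open>z\<close> is a lower bound \<open>- f z / a z\<close> where \<open>a z > 0\<close> and
  an upper bound \<open>f z / (- a z)\<close> where \<open>a z < 0\<close>.  The bounds are compatible because \<open>f\<close> is nonnegative at
  the point \<open>v\<close> of the segment from \<open>z1\<close> to \<open>z2\<close> at which the linear interpolation of \<open>a\<close> vanishes.
  The last premise offers the convexity inequality at \<open>v\<close> for every convex \<open>b\<close>, so that it can be
  applied to \<open>a\<close> alone (inequality constraint) or to \<open>a\<close> and \<open>- a\<close> (equality constraint).\<close>

lemma crossing_slopes:
  fixes f a :: "'a::real_vector \<Rightarrow> real"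
  assumes f: "convex_on E f" and z: "z1 \<in> E" "z2 \<in> E" and a: "a z1 > 0" "a z2 < 0"
    and nonneg: "\<And>v. v \<in> E \<Longrightarrow>
      (\<And>b. convex_on E b \<Longrightarrow> (a z1 - a z2) * b v \<le> - a z2 * b z1 + a z1 * b z2) \<Longrightarrow> 0 \<le> f v"
  shows "- f z1 / a z1 \<le> f z2 / (- a z2)"
proof -
  define v where "v = (- a z2 / (- a z2 + a z1)) *\<^sub>R z1 + (a z1 / (- a z2 + a z1)) *\<^sub>R z2"
  have pos: "- a z2 > 0"
    using a by simp
  have v: "v \<in> E"
    using convex_combination_ratio(1)[OF f z pos a(1)] by (simp add: v_def)
  have b: "(a z1 - a z2) * b v \<le> - a z2 * b z1 + a z1 * b z2" if "convex_on E b" for b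
    using convex_combination_ratio(3)[OF that z pos a(1)] by (simp add: v_def)
  have "0 \<le> (a z1 - a z2) * f v"
    using nonneg[OF v b] a by simp
  also have "\<dots> \<le> - a z2 * f z1 + a z1 * f z2"
    using b[OF f] .
  finally show ?thesis
    using a by (simp add: field_simps)
qed

text \<open>Slater's condition \<open>a z0 < 0\<close> provides an upper bound, so the supremum of the lower bounds is
  finite; \<open>0\<close> is admitted among the lower bounds to make the multiplier nonnegative.\<close>

lemma inequality_multiplier:
  fixes f a :: "'a::real_vector \<Rightarrow> real"
  assumes f: "convex_on E f" and a: "convex_on E a" and z0: "z0 \<in> E" "a z0 < 0"
    and nonneg: "\<And>z. z \<in> E \<Longrightarrow> a z \<le> 0 \<Longrightarrow> 0 \<le> f z"
  obtains l where "l \<ge> 0" "\<And>z. z \<in> E \<Longrightarrow> 0 \<le> f z + l * a z"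
proof -
  define L where "L = insert 0 ((\<lambda>z. - f z / a z) ` {z \<in> E. a z > 0})"
  define U where "U = (\<lambda>z. f z / (- a z)) ` {z \<in> E. a z < 0}"
  have cross: "- f z1 / a z1 \<le> f z2 / (- a z2)"
    if z: "z1 \<in> E" "z2 \<in> E" "a z1 > 0" "a z2 < 0" for z1 z2
  proof (rule crossing_slopes[where E = E])
    fix v assume v: "v \<in> E"
      "\<And>b. convex_on E b \<Longrightarrow> (a z1 - a z2) * b v \<le> - a z2 * b z1 + a z1 * b z2"
    have "(a z1 - a z2) * a v \<le> 0"
      using v(2)[OF a] by simp
    then have "a v \<le> 0"
      using z by (simp add: mult_le_0_iff)
    then show "0 \<le> f v"
      using nonneg v(1) by blast
  qed (use f z in auto)
  have "0 \<le> f z / (- a z)" if "z \<in> E" "a z < 0" for z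
    using nonneg[of z] that by (intro divide_nonneg_pos) auto
  then obtain c where c: "\<And>l. l \<in> L \<Longrightarrow> l \<le> c" "\<And>u. u \<in> U \<Longrightarrow> c \<le> u"
    using real_between[of L U] cross z0 unfolding L_def U_def by blast
  show ?thesis
  proof (rule that[of c])
    show "c \<ge> 0"
      using c(1) by (simp add: L_def)
    show "0 \<le> f z + c * a z" if "z \<in> E" for z
      by (rule multiplier_from_slopes[where E = E]) (use c that nonneg in \<open>auto simp: L_def U_def\<close>)
  qed
qed

text \<open>The point \<open>z0\<close> divides the segment from \<open>z\<close> to its reflection in the ratio of \<open>1\<close> to \<open>s\<close>, and a function
  that is convex and concave is affine along that segment.\<close>

lemma reflection_value:
  fixes a :: "'a::real_vector \<Rightarrow> real"
  assumes a: "convex_on E a" "convex_on E (\<lambda>z. - a z)" and z0: "a z0 = 0"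
    and z: "z \<in> E" "s > 0" "z0 - s *\<^sub>R (z - z0) \<in> E"
  shows "a (z0 - s *\<^sub>R (z - z0)) = - s * a z"
proof -
  have "(s + 1) *\<^sub>R ((s / (s + 1)) *\<^sub>R z + (1 / (s + 1)) *\<^sub>R (z0 - s *\<^sub>R (z - z0))) = (s + 1) *\<^sub>R z0"
    using convex_combination_ratio(2)[OF a(1) z(1,3,2), of 1] by (simp add: algebra_simps)
  then have "(s / (s + 1)) *\<^sub>R z + (1 / (s + 1)) *\<^sub>R (z0 - s *\<^sub>R (z - z0)) = z0"
    using z(2) by (subst (asm) scaleR_cancel_left) simp
  then show ?thesis
    using convex_combination_ratio(3)[OF a(1) z(1,3,2), of 1]
      convex_combination_ratio(3)[OF a(2) z(1,3,2), of 1] z0 by simp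
qed

text \<open>If \<open>a\<close> does not vanish identically, the reflection through \<open>z0\<close> shows that it takes both signs, so
  there are lower and upper bounds for the multiplier.  The hypothesis on \<open>z0\<close> says that it lies in
  the core of \<open>E\<close> relative to the affine hull of \<open>E\<close>.\<close>

lemma equality_multiplier:
  fixes f a :: "'a::real_vector \<Rightarrow> real"
  assumes f: "convex_on E f" and a: "convex_on E a" "convex_on E (\<lambda>z. - a z)"
    and z0: "a z0 = 0" and rcore: "\<And>z. z \<in> E \<Longrightarrow> \<exists>s>0. z0 - s *\<^sub>R (z - z0) \<in> E"
    and nonneg: "\<And>z. z \<in> E \<Longrightarrow> a z = 0 \<Longrightarrow> 0 \<le> f z"
  obtains l where "\<And>z. z \<in> E \<Longrightarrow> 0 \<le> f z + l * a z"
proof (cases "\<forall>z\<in>E. a z = 0")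
  case True
  then show ?thesis
    using that[of 0] nonneg by simp
next
  case False
  then obtain z where z: "z \<in> E" "a z \<noteq> 0"
    by blast
  then obtain s where s: "s > 0" "z0 - s *\<^sub>R (z - z0) \<in> E"
    using rcore by blast
  have refl: "a (z0 - s *\<^sub>R (z - z0)) = - s * a z"
    using reflection_value[OF a z0 z(1) s] .
  have "\<exists>z\<in>E. a z > 0" "\<exists>z\<in>E. a z < 0"
    using z s refl by (metis linorder_neqE mult_pos_pos mult_minus_left mult_pos_neg
        neg_0_less_iff_less neg_less_0_iff_less)+
  then have ne: "{z \<in> E. a z > 0} \<noteq> {}" "{z \<in> E. a z < 0} \<noteq> {}"
    by auto
  have cross: "- f z1 / a z1 \<le> f z2 / (- a z2)"
    if z: "z1 \<in> E" "z2 \<in> E" "a z1 > 0" "a z2 < 0" for z1 z2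
  proof (rule crossing_slopes[where E = E])
    fix v assume v: "v \<in> E"
      "\<And>b. convex_on E b \<Longrightarrow> (a z1 - a z2) * b v \<le> - a z2 * b z1 + a z1 * b z2"
    have "(a z1 - a z2) * a v = 0"
      using v(2)[OF a(1)] v(2)[OF a(2)] by simp
    then have "a v = 0"
      using z by simp
    then show "0 \<le> f v"
      using nonneg v(1) by blast
  qed (use f z in auto)
  obtain c where c: "\<And>l. l \<in> (\<lambda>z. - f z / a z) ` {z \<in> E. a z > 0} \<Longrightarrow> l \<le> c"
      "\<And>u. u \<in> (\<lambda>z. f z / (- a z)) ` {z \<in> E. a z < 0} \<Longrightarrow> c \<le> u"
    using real_between[of "(\<lambda>z. - f z / a z) ` {z \<in> E. a z > 0}"
        "(\<lambda>z. f z / (- a z)) ` {z \<in> E. a z < 0}"] cross ne by blast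
  have "0 \<le> f z + c * a z" if "z \<in> E" for z
    by (rule multiplier_from_slopes[where E = E]) (use c that nonneg in auto)
  then show ?thesis
    using that by blast
qed

text \<open>The constraints move into the objective one by one: the multiplier of the constraint \<open>i\<close> is
  found on the set where the constraints still present hold, and \<open>f + l g\<^sub>i\<close> is the objective for them.\<close>

lemma inequality_multipliers:
  fixes f :: "'a::real_vector \<Rightarrow> real" and g :: "'i \<Rightarrow> 'a \<Rightarrow> real"
  assumes "finite I" and "convex_on E f" and "\<And>i. i \<in> I \<Longrightarrow> convex_on E (g i)"
    and "z0 \<in> E" and "\<And>i. i \<in> I \<Longrightarrow> g i z0 < 0"
    and "\<And>z. z \<in> E \<Longrightarrow> (\<And>i. i \<in> I \<Longrightarrow> g i z \<le> 0) \<Longrightarrow> 0 \<le> f z"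
  shows "\<exists>lam. (\<forall>i\<in>I. lam i \<ge> 0) \<and> (\<forall>z\<in>E. 0 \<le> f z + (\<Sum>i\<in>I. lam i * g i z))"
  using assms
proof (induction I arbitrary: f rule: finite_induct)
  case empty
  then show ?case by simp
next
  case (insert i I)
  define E' where "E' = {z \<in> E. \<forall>i\<in>I. g i z \<le> 0}"
  have "convex E"
    using insert.prems(1) by (simp add: convex_on_def)
  then have E': "E' \<subseteq> E" "convex E'"
    using insert.prems(2) unfolding E'_def by (auto intro: convex_sublevel_set)
  have z0: "z0 \<in> E'" "g i z0 < 0"
    using insert.prems(3,4) by (auto simp: E'_def less_imp_le)
  have gi: "convex_on E (g i)"
    using insert.prems(2) by simp
  have nonneg: "0 \<le> f z" if "z \<in> E'" "g i z \<le> 0" for z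
    using that insert.prems(5)[of z] by (auto simp: E'_def)
  obtain l where l: "l \<ge> 0" "\<And>z. z \<in> E' \<Longrightarrow> 0 \<le> f z + l * g i z"
    using inequality_multiplier[OF convex_on_subset[OF insert.prems(1) E'] convex_on_subset[OF gi E'] z0 nonneg]
    by blast
  have "\<exists>lam. (\<forall>i\<in>I. lam i \<ge> 0) \<and> (\<forall>z\<in>E. 0 \<le> (f z + l * g i z) + (\<Sum>i\<in>I. lam i * g i z))"
  proof (rule insert.IH)
    show "convex_on E (\<lambda>z. f z + l * g i z)"
      using insert.prems(1) gi l(1) by (intro convex_on_add convex_on_cmul)
    show "0 \<le> f z + l * g i z" if "z \<in> E" "\<And>i. i \<in> I \<Longrightarrow> g i z \<le> 0" for z
      using l(2) that by (simp add: E'_def)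
  qed (use insert.prems in auto)
  then obtain lam where lam: "\<forall>i\<in>I. lam i \<ge> 0"
      "\<forall>z\<in>E. 0 \<le> (f z + l * g i z) + (\<Sum>i\<in>I. lam i * g i z)"
    by blast
  have "(\<Sum>j\<in>insert i I. (lam(i := l)) j * g j z) = l * g i z + (\<Sum>i\<in>I. lam i * g i z)" for z
    using insert.hyps by (auto intro!: sum.cong)
  then show ?case
    using lam l(1) insert.hyps by (intro exI[of _ "lam(i := l)"]) (auto simp: add.assoc)
qed

text \<open>As for inequalities.  The relative core condition, unlike membership in the interior, passes to
  the sets cut out by the constraints still present, since reflection through \<open>z0\<close> preserves the zeros of
  \<open>h\<^sub>i\<close>.  Where the \<open>h\<^sub>j\<close> are linearly dependent, some constraint vanishes
  identically on such a set and receives the multiplier \<open>0\<close>.\<close>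

lemma equality_multipliers:
  fixes f :: "'a::real_vector \<Rightarrow> real" and h :: "'i \<Rightarrow> 'a \<Rightarrow> real"
  assumes "finite J" and "convex_on E f"
    and "\<And>j. j \<in> J \<Longrightarrow> convex_on E (h j)" and "\<And>j. j \<in> J \<Longrightarrow> convex_on E (\<lambda>z. - h j z)"
    and rcore: "\<And>z. z \<in> E \<Longrightarrow> \<exists>s>0. z0 - s *\<^sub>R (z - z0) \<in> E"
    and "\<And>j. j \<in> J \<Longrightarrow> h j z0 = 0"
    and "\<And>z. z \<in> E \<Longrightarrow> (\<And>j. j \<in> J \<Longrightarrow> h j z = 0) \<Longrightarrow> 0 \<le> f z"
  shows "\<exists>nu. \<forall>z\<in>E. 0 \<le> f z + (\<Sum>j\<in>J. nu j * h j z)"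
  using assms
proof (induction J arbitrary: f rule: finite_induct)
  case empty
  then show ?case by simp
next
  case (insert j J)
  define E' where "E' = {z \<in> E. \<forall>j\<in>J. h j z = 0}"
  have "convex E"
    using insert.prems(1) by (simp add: convex_on_def)
  then have E': "E' \<subseteq> E" "convex E'"
    using insert.prems(2,3) unfolding E'_def by (auto intro: convex_zero_set)
  have hj: "convex_on E (h j)" "convex_on E (\<lambda>z. - h j z)" "h j z0 = 0"
    using insert.prems(2,3,5) by simp_all
  have rcore': "\<exists>s>0. z0 - s *\<^sub>R (z - z0) \<in> E'" if z: "z \<in> E'" for z
  proof -
    obtain s where s: "s > 0" "z0 - s *\<^sub>R (z - z0) \<in> E"
      using z insert.prems(4) E'(1) by blast
    have "h i (z0 - s *\<^sub>R (z - z0)) = 0" if "i \<in> J" for i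
      using reflection_value[of E "h i" z0 z s] insert.prems(2,3,5)[of i] that z s
      by (simp add: E'_def)
    then show ?thesis
      using s by (auto simp: E'_def)
  qed
  have nonneg: "0 \<le> f z" if "z \<in> E'" "h j z = 0" for z
    using that insert.prems(6)[of z] by (auto simp: E'_def)
  obtain l where l: "\<And>z. z \<in> E' \<Longrightarrow> 0 \<le> f z + l * h j z"
    using equality_multiplier[OF convex_on_subset[OF insert.prems(1) E']
        convex_on_subset[OF hj(1) E'] convex_on_subset[OF hj(2) E'] hj(3) rcore' nonneg]
    by blast
  have "convex_on E (\<lambda>z. l * h j z)"
  proof (cases "l \<ge> 0")
    case True
    then show ?thesis
      using hj by (intro convex_on_cmul)
  next
    case False
    then show ?thesis
      using convex_on_cmul[OF _ hj(2), of "- l"] by simp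
  qed
  then have conv: "convex_on E (\<lambda>z. f z + l * h j z)"
    using insert.prems(1) by (intro convex_on_add)
  have "\<exists>nu. \<forall>z\<in>E. 0 \<le> (f z + l * h j z) + (\<Sum>j\<in>J. nu j * h j z)"
    using conv insert.prems l by (intro insert.IH) (auto simp: E'_def)
  then obtain nu where nu: "\<forall>z\<in>E. 0 \<le> (f z + l * h j z) + (\<Sum>j\<in>J. nu j * h j z)"
    by blast
  have "(\<Sum>i\<in>insert j J. (nu(j := l)) i * h i z) = l * h j z + (\<Sum>i\<in>J. nu i * h i z)" for z
    using insert.hyps by (auto intro!: sum.cong)
  then show ?case
    using nu by (intro exI[of _ "nu(j := l)"]) (auto simp: add.assoc)
qed

text \<open>Inequalities are removed first, on the set where all the equalities hold, because there \<open>z0\<close> is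
  still a Slater point; the equalities then only need the relative core condition.\<close>

theorem lagrange_multipliers:
  fixes f :: "'a::real_vector \<Rightarrow> real" and g :: "'i \<Rightarrow> 'a \<Rightarrow> real" and h :: "'j \<Rightarrow> 'a \<Rightarrow> real"
  assumes fin: "finite I" "finite J" and f: "convex_on E f"
    and g: "\<And>i. i \<in> I \<Longrightarrow> convex_on E (g i)"
    and h: "\<And>j. j \<in> J \<Longrightarrow> convex_on E (h j)" "\<And>j. j \<in> J \<Longrightarrow> convex_on E (\<lambda>z. - h j z)"
    and z0: "z0 \<in> E" and rcore: "\<And>z. z \<in> E \<Longrightarrow> \<exists>s>0. z0 - s *\<^sub>R (z - z0) \<in> E"
    and slater: "\<And>i. i \<in> I \<Longrightarrow> g i z0 < 0" "\<And>j. j \<in> J \<Longrightarrow> h j z0 = 0"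
    and nonneg: "\<And>z. z \<in> E \<Longrightarrow> (\<And>i. i \<in> I \<Longrightarrow> g i z \<le> 0) \<Longrightarrow> (\<And>j. j \<in> J \<Longrightarrow> h j z = 0) \<Longrightarrow> 0 \<le> f z"
  obtains lam nu where "\<And>i. i \<in> I \<Longrightarrow> lam i \<ge> 0"
    "\<And>z. z \<in> E \<Longrightarrow> 0 \<le> f z + (\<Sum>i\<in>I. lam i * g i z) + (\<Sum>j\<in>J. nu j * h j z)"
proof -
  define E' where "E' = {z \<in> E. \<forall>j\<in>J. h j z = 0}"
  have "convex E"
    using f by (simp add: convex_on_def)
  then have E': "E' \<subseteq> E" "convex E'"
    using h unfolding E'_def by (auto intro: convex_zero_set)
  have "\<exists>lam. (\<forall>i\<in>I. lam i \<ge> 0) \<and> (\<forall>z\<in>E'. 0 \<le> f z + (\<Sum>i\<in>I. lam i * g i z))"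
  proof (rule inequality_multipliers[OF fin(1)])
    show "0 \<le> f z" if "z \<in> E'" "\<And>i. i \<in> I \<Longrightarrow> g i z \<le> 0" for z
      using that nonneg[of z] by (auto simp: E'_def)
    show "z0 \<in> E'"
      using z0 slater by (auto simp: E'_def)
  qed (use f g slater E' in \<open>auto intro: convex_on_subset\<close>)
  then obtain lam where lam: "\<And>i. i \<in> I \<Longrightarrow> lam i \<ge> 0"
      "\<And>z. z \<in> E' \<Longrightarrow> 0 \<le> f z + (\<Sum>i\<in>I. lam i * g i z)"
    by blast
  have "convex_on E (\<lambda>z. \<Sum>i\<in>I. lam i * g i z)"
    using convex_on_weighted_sum[OF fin(1) \<open>convex E\<close> lam(1) g] .
  then have "\<exists>nu. \<forall>z\<in>E. 0 \<le> (f z + (\<Sum>i\<in>I. lam i * g i z)) + (\<Sum>j\<in>J. nu j * h j z)"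
    using lam(2) f h slater(2) rcore
    by (intro equality_multipliers[OF fin(2)]) (auto simp: E'_def)
  then show ?thesis
    using that lam(1) by blast
qed

section \<open>Continuity of linear functionals bounded above\<close>

lemma tendsto_translate_scale:
  fixes z0 a :: "'a::locally_convex_t2_space"
  shows "((\<lambda>z. z0 + s *\<^sub>R (z - a)) \<longlongrightarrow> z0) (nhds a)"
proof -
  have "((\<lambda>z. z0 + s *\<^sub>R (z - a)) \<longlongrightarrow> z0 + s *\<^sub>R (a - a)) (nhds a)"
    by (intro tendsto_add tendsto_scaleR_locally_convex tendsto_diff tendsto_const filterlim_ident)
  then show ?thesis
    by simp
qed

text \<open>The upper bound on \<open>U\<close> is used at the points \<open>z0 + s (z - a)\<close> and \<open>z0 - s (z - a)\<close>, which both lie in \<open>U\<close>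
  for \<open>z\<close> near \<open>a\<close>, however large \<open>s\<close> is.\<close>

lemma linear_bounded_above_continuous:
  fixes u :: "'a::locally_convex_t2_space \<Rightarrow> real"
  assumes u: "linear u" and U: "open U" "z0 \<in> U" and le: "\<And>z. z \<in> U \<Longrightarrow> u z \<le> c"
  shows "u \<in> top_dual"
proof -
  have "(u \<longlongrightarrow> u a) (nhds a)" for a
  proof (rule tendstoI)
    fix e :: real assume e: "e > 0"
    \<comment> \<open>\<open>c - u z0\<close> bounds the oscillation \<open>s * \<bar>u z - u a\<bar>\<close>; the summand \<open>1\<close> makes \<open>s\<close> positive and the bound strict.\<close>
    define s where "s = (c - u z0 + 1) / e"
    have c: "c - u z0 + 1 > 0"
      using le[OF U(2)] by simp
    have "\<forall>\<^sub>F z in nhds a. z0 + s *\<^sub>R (z - a) \<in> U" "\<forall>\<^sub>F z in nhds a. z0 + (- s) *\<^sub>R (z - a) \<in> U"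
      using U by (rule topological_tendstoD[OF tendsto_translate_scale])+
    then show "\<forall>\<^sub>F z in nhds a. dist (u z) (u a) < e"
    proof eventually_elim
      case (elim z)
      have "u z0 + s * (u z - u a) \<le> c" "u z0 + (- s) * (u z - u a) \<le> c"
        using le[OF elim(1)] le[OF elim(2)] u by (simp_all add: linear_add linear_diff linear_scale)
      then have "s * \<bar>u z - u a\<bar> < c - u z0 + 1"
        by (cases "u a \<le> u z") (simp_all add: algebra_simps)
      then have "(c - u z0 + 1) * \<bar>u z - u a\<bar> < (c - u z0 + 1) * e"
        using e by (simp add: s_def field_simps)
      then show ?case
        using c by (simp add: dist_real_def)
    qed
  qed
  then have "continuous_on UNIV u"
    unfolding continuous_on_def by (meson at_le filterlim_mono order_refl tendsto_mono at_within_le_nhds)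
  then show ?thesis
    using u by (simp add: top_dual_def)
qed

lemma linear_majorized_continuous:
  fixes u :: "'a::locally_convex_t2_space \<Rightarrow> real"
  assumes u: "linear u" and z0: "z0 \<in> interior E" and F: "isCont F z0"
    and le: "\<And>z. z \<in> E \<Longrightarrow> u (z - a) \<le> F z"
  shows "u \<in> top_dual"
proof -
  have "\<forall>\<^sub>F z in nhds z0. F z < F z0 + 1"
    using F order_tendstoD(2)[of F "F z0" "nhds z0" "F z0 + 1"]
    by (simp add: isCont_def tendsto_at_iff_tendsto_nhds)
  then obtain U where U: "open U" "z0 \<in> U" "\<And>z. z \<in> U \<Longrightarrow> F z < F z0 + 1"
    unfolding eventually_nhds by blast
  show ?thesis
  proof (rule linear_bounded_above_continuous[OF u])
    show "open (U \<inter> interior E)" "z0 \<in> U \<inter> interior E"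
      using U z0 by auto
    show "u z \<le> F z0 + 1 + u a" if "z \<in> U \<inter> interior E" for z
      using that U(3)[of z] le[of z] interior_subset[of E] u by (auto simp: linear_diff)
  qed
qed

lemma interior_imp_core:
  fixes z0 d :: "'a::locally_convex_t2_space"
  assumes "z0 \<in> interior E"
  shows "\<exists>s>0. z0 + s *\<^sub>R d \<in> E"
proof -
  have "((\<lambda>s::real. z0 + s *\<^sub>R d) \<longlongrightarrow> z0 + 0 *\<^sub>R d) (at_right 0)"
    by (intro tendsto_add tendsto_scaleR_locally_convex tendsto_const tendsto_ident_at)
  then have "\<forall>\<^sub>F s in at_right 0. z0 + s *\<^sub>R d \<in> interior E"
    using assms by (intro topological_tendstoD) auto
  moreover have "\<forall>\<^sub>F s :: real in at_right 0. s > 0"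
    by (simp add: eventually_at_right_less)
  ultimately have "\<forall>\<^sub>F s :: real in at_right 0. s > 0 \<and> z0 + s *\<^sub>R d \<in> interior E"
    by eventually_elim simp
  then show ?thesis
    using interior_subset eventually_happens'[OF trivial_limit_at_right_real] by blast
qed

section \<open>Subgradient calculus\<close>

lemma top_dual_zero: "0 \<in> top_dual"
  by (auto simp: top_dual_def zero_fun_def intro: linear_zero)

lemma top_dual_add:
  assumes "u \<in> top_dual" "v \<in> top_dual"
  shows "u + v \<in> top_dual"
  using assms by (auto simp: top_dual_def plus_fun_def intro: linear_compose_add continuous_on_add)

lemma top_dual_scale:
  assumes "u \<in> top_dual"
  shows "(\<lambda>z. c * u z) \<in> top_dual"
  using assms linear_compose_scale_right[of u c]
  by (auto simp: top_dual_def intro: continuous_on_mult_left)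

text \<open>The subdifferential at \<open>a\<close> of the function equal to \<open>f\<close> on \<open>E\<close> and to \<open>+\<infinity>\<close> elsewhere.  Keeping the
  domain separate from a real-valued function avoids extended-real arithmetic, and \<open>f = 0\<close> gives the
  normal cone of \<open>E\<close>.\<close>

definition subgradients ::
  "'a::{real_vector,topological_space} set \<Rightarrow> ('a \<Rightarrow> real) \<Rightarrow> 'a \<Rightarrow> ('a \<Rightarrow> real) set" where
  "subgradients E f a = {u \<in> top_dual. \<forall>z\<in>E. u (z - a) \<le> f z - f a}"

text \<open>Continuity of the parts is automatic: the first is majorised near \<open>z0\<close> by the continuous \<open>f1\<close>, and
  the second is the difference of two continuous functionals.\<close>

lemma subgradients_sum_rule:
  fixes f1 f2 :: "'a::locally_convex_t2_space \<Rightarrow> real"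
  assumes f1: "convex_on E1 f1" and f2: "convex_on E2 f2"
    and z0: "z0 \<in> interior E1" "z0 \<in> E2" and cont: "isCont f1 z0"
    and a: "a \<in> E1" "a \<in> E2"
  shows "subgradients (E1 \<inter> E2) (\<lambda>z. f1 z + f2 z) a = subgradients E1 f1 a + subgradients E2 f2 a"
proof (intro equalityI subsetI)
  fix w assume "w \<in> subgradients (E1 \<inter> E2) (\<lambda>z. f1 z + f2 z) a"
  then have w: "w \<in> top_dual" "linear w"
    "\<And>z. z \<in> E1 \<Longrightarrow> z \<in> E2 \<Longrightarrow> w (z - a) \<le> (f1 z - f1 a) + (f2 z - f2 a)"
    by (force simp: subgradients_def top_dual_def)+
  obtain u1 u2 where u: "linear u1" "linear u2" "w = u1 + u2"
    "\<And>z. z \<in> E1 \<Longrightarrow> u1 (z - a) \<le> f1 z - f1 a" "\<And>z. z \<in> E2 \<Longrightarrow> u2 (z - a) \<le> f2 z - f2 a"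
    using convex_sum_rule[OF f1 f2 w(2) interior_imp_core[OF z0(1)] z0(2) a w(3)] by blast
  have "isCont (\<lambda>z. f1 z - f1 a) z0"
    using cont by simp
  then have u1: "u1 \<in> top_dual"
    using linear_majorized_continuous[OF u(1) z0(1)] u(4) by blast
  have "u2 = w + (\<lambda>z. - 1 * u1 z)"
    using u(3) by auto
  then have "u2 \<in> top_dual"
    using top_dual_add[OF w(1) top_dual_scale[OF u1]] by metis
  then show "w \<in> subgradients E1 f1 a + subgradients E2 f2 a"
    using u1 u by (auto simp: subgradients_def)
next
  fix w assume "w \<in> subgradients E1 f1 a + subgradients E2 f2 a"
  then obtain u1 u2 where "w = u1 + u2" "u1 \<in> subgradients E1 f1 a" "u2 \<in> subgradients E2 f2 a"
    by (rule set_plus_elim)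
  then show "w \<in> subgradients (E1 \<inter> E2) (\<lambda>z. f1 z + f2 z) a"
    by (force simp: subgradients_def intro: top_dual_add)
qed

text \<open>Restricted to \<open>{a}\<close>, the function has the subgradient \<open>0\<close>; the sum rule splits it into a subgradient of
  \<open>f\<close> and a normal to \<open>{a}\<close>.\<close>

lemma subgradients_nonempty:
  fixes f :: "'a::locally_convex_t2_space \<Rightarrow> real"
  assumes "convex_on UNIV f" "isCont f a"
  shows "subgradients UNIV f a \<noteq> {}"
proof -
  have "subgradients (UNIV \<inter> {a}) (\<lambda>z. f z + 0) a = subgradients UNIV f a + subgradients {a} (\<lambda>_. 0) a"
    using assms by (intro subgradients_sum_rule[where ?z0.0 = a]) (auto simp: convex_on_const)
  moreover have "0 \<in> subgradients (UNIV \<inter> {a}) (\<lambda>z. f z + 0) a"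
    by (simp add: subgradients_def top_dual_zero)
  ultimately show ?thesis
    by (auto elim: set_plus_elim)
qed

lemma linear_nonpos_imp_zero:
  fixes u :: "'a::real_vector \<Rightarrow> real"
  assumes "linear u" "\<And>z. u (z - a) \<le> 0"
  shows "u = 0"
proof
  fix z
  have "u z \<le> 0" "u (- z) \<le> 0"
    using assms(2)[of "z + a"] assms(2)[of "- z + a"] by simp_all
  then show "u z = 0 z"
    using assms(1) by (simp add: linear_neg)
qed

lemma subgradients_zero_fun: "subgradients UNIV (\<lambda>_. 0) a = 0"
  using linear_nonpos_imp_zero[of _ a]
  by (auto simp: subgradients_def top_dual_zero top_dual_def[symmetric] set_zero)
     (auto simp: top_dual_def)

text \<open>For \<open>c = 0\<close> the left side is \<open>{0}\<close>, so the equality rests on the existence of a subgradient of \<open>f\<close>.\<close>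

lemma subgradients_scale:
  fixes f :: "'a::locally_convex_t2_space \<Rightarrow> real"
  assumes "convex_on UNIV f" "isCont f a" "c \<ge> 0"
  shows "subgradients UNIV (\<lambda>z. c * f z) a = scale_set c (subgradients UNIV f a)"
proof (cases "c = 0")
  case True
  then show ?thesis
    using subgradients_nonempty[OF assms(1,2)] subgradients_zero_fun[of a]
    by (auto simp: scale_set_def set_zero zero_fun_def)
next
  case False
  with assms have c: "c > 0"
    by simp
  show ?thesis
  proof (intro equalityI subsetI)
    fix u assume u: "u \<in> subgradients UNIV (\<lambda>z. c * f z) a"
    then have "(\<lambda>z. (1/c) * u z) \<in> subgradients UNIV f a"
      using c unfolding subgradients_def
      by (auto intro!: top_dual_scale[of u "1/c", simplified] simp: field_simps)
    then show "u \<in> scale_set c (subgradients UNIV f a)"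
      using c unfolding scale_set_def by (intro image_eqI[of _ _ "\<lambda>z. (1/c) * u z"]) auto
  next
    fix u assume "u \<in> scale_set c (subgradients UNIV f a)"
    then obtain v where "u = (\<lambda>z. c * v z)" "v \<in> subgradients UNIV f a"
      by (auto simp: scale_set_def)
    then show "u \<in> subgradients UNIV (\<lambda>z. c * f z) a"
      using c mult_left_mono[of "v (_ - a)" _ c]
      by (auto simp: subgradients_def right_diff_distrib[symmetric] intro: top_dual_scale)
  qed
qed

lemma subgradients_affine:
  assumes u: "u \<in> top_dual"
  shows "subgradients UNIV (\<lambda>z. u z - b) a = {u}"
proof -
  have "v = u" if v: "v \<in> subgradients UNIV (\<lambda>z. u z - b) a" for v
  proof -
    have l: "linear u" "linear v"
      using u v by (auto simp: subgradients_def top_dual_def)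
    have "(v - u) (z - a) \<le> 0" for z
      using v l by (force simp: subgradients_def linear_diff)
    moreover have "linear (v - u)"
      using linear_compose_sub[OF l(2,1)] by (simp add: fun_diff_def)
    ultimately show ?thesis
      using linear_nonpos_imp_zero by (metis right_minus_eq)
  qed
  moreover have "u \<in> subgradients UNIV (\<lambda>z. u z - b) a"
    using u by (auto simp: subgradients_def top_dual_def linear_diff)
  ultimately show ?thesis
    by blast
qed

lemma subgradients_finite_sum:
  fixes f :: "'i \<Rightarrow> 'a::locally_convex_t2_space \<Rightarrow> real"
  assumes "finite I" "\<And>i. i \<in> I \<Longrightarrow> convex_on UNIV (f i)"
    "\<And>i z. i \<in> I \<Longrightarrow> isCont (f i) z"
  shows "subgradients UNIV (\<lambda>z. \<Sum>i\<in>I. f i z) a = (\<Sum>i\<in>I. subgradients UNIV (f i) a)"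
  using assms
proof (induction I rule: finite_induct)
  case empty
  then show ?case
    by (simp add: subgradients_zero_fun)
next
  case (insert i I)
  have conv: "convex_on UNIV (\<lambda>z. \<Sum>i\<in>I. f i z)"
    using convex_on_weighted_sum[of I UNIV "\<lambda>_. 1" f] insert by simp
  have "subgradients (UNIV \<inter> UNIV) (\<lambda>z. f i z + (\<Sum>i\<in>I. f i z)) a =
      subgradients UNIV (f i) a + subgradients UNIV (\<lambda>z. \<Sum>i\<in>I. f i z) a"
    using insert.prems conv by (intro subgradients_sum_rule[where ?z0.0 = a]) auto
  then show ?case
    using insert by simp
qed

section \<open>Extended-real-valued functions\<close>

lemma subdiff_real: "subdiff (\<lambda>z. ereal (f z)) a = subgradients UNIV f a"
  by (simp add: subdiff_def subgradients_def)

lemma subdiff_extension: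
  assumes "a \<in> E" "\<And>z. F z = (if z \<in> E then ereal (f z) else \<infinity>)"
  shows "subdiff F a = subgradients E f a"
  using assms(1) by (auto simp: subdiff_def subgradients_def assms(2) split: if_splits)

lemma normal_cone_eq: "normal_cone a E = subgradients E (\<lambda>_. 0) a"
  by (simp add: normal_cone_def subgradients_def)

lemma edom_iff: "z \<in> edom f \<longleftrightarrow> (\<exists>\<alpha>. f z \<le> ereal \<alpha>)"
proof
  assume "z \<in> edom f"
  then show "\<exists>\<alpha>. f z \<le> ereal \<alpha>"
    by (auto simp: edom_def less_PInf_Ex_of_nat intro: less_imp_le)
qed (auto simp: edom_def intro: le_less_trans)

text \<open>The normal \<open>(u, 0)\<close> ignores the vertical coordinate, and every point of the domain has some
  point of the epigraph above it, even where \<open>f\<close> is \<open>-\<infinity>\<close>.\<close>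

lemma singular_subdiff_eq:
  assumes fin: "\<bar>f a\<bar> \<noteq> \<infinity>"
  shows "singular_subdiff f a = subgradients (edom f) (\<lambda>_. 0) a"
proof -
  have "(\<forall>p\<in>epi f. dual_pair u 0 (p - (a, real_of_ereal (f a))) \<le> 0) \<longleftrightarrow> (\<forall>z\<in>edom f. u (z - a) \<le> 0)"
    for u
  proof
    assume *: "\<forall>p\<in>epi f. dual_pair u 0 (p - (a, real_of_ereal (f a))) \<le> 0"
    show "\<forall>z\<in>edom f. u (z - a) \<le> 0"
    proof
      fix z assume "z \<in> edom f"
      then obtain \<alpha> where "f z \<le> ereal \<alpha>"
        by (auto simp: edom_iff)
      then show "u (z - a) \<le> 0"
        using * by (force simp: epi_def dual_pair_def)
    qed
  next
    assume "\<forall>z\<in>edom f. u (z - a) \<le> 0"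
    then show "\<forall>p\<in>epi f. dual_pair u 0 (p - (a, real_of_ereal (f a))) \<le> 0"
      by (force simp: epi_def edom_iff dual_pair_def)
  qed
  then show ?thesis
    using fin dual_pair_in_top_dual[OF _ top_dual_zero]
    by (auto simp: singular_subdiff_def subgradients_def normal_cone_def)
qed

lemma convex_edom:
  assumes "convex_fun f"
  shows "convex (edom f)"
proof -
  have "edom f = fst ` epi f"
    by (force simp: edom_iff epi_def)
  then show ?thesis
    using assms convex_linear_image[OF linear_fst] by (simp add: convex_fun_def)
qed

lemma finite_continuous_interior_edom:
  assumes "finite_continuous_at f z"
  shows "z \<in> interior (edom f)"
proof -
  have "f z < \<infinity>"
    using assms by (auto simp: finite_continuous_at_def)
  then have "\<forall>\<^sub>F y in nhds z. f y < \<infinity>"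
    using assms by (auto simp: finite_continuous_at_def isCont_def tendsto_at_iff_tendsto_nhds
        dest: order_tendstoD(2))
  then show ?thesis
    unfolding eventually_nhds edom_def by (auto intro: interiorI)
qed

section \<open>The Lagrangian and the optimal value function\<close>

lemma subdiff_Lhat:
  assumes "a \<in> edom \<phi>" "a \<in> C"
  shows "subdiff (Lhat \<phi> C m g k h lam \<nu>) a = subgradients (edom \<phi> \<inter> C)
    (\<lambda>z. (\<Sum>i\<in>{1..m}. lam i * g i z) + (\<Sum>j\<in>{1..k}. \<nu> j * h j z)) a"
  using assms by (intro subdiff_extension) (auto simp: Lhat_def ind_fun_def)

text \<open>The sum rule peels off \<open>D\<close> and \<open>C\<close> in turn; each has \<open>z0\<close> in its interior, where the zero function on it
  is continuous.  The remaining functions are continuous on the whole space.\<close>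

lemma subgradients_lagrangian:
  fixes g h :: "'i \<Rightarrow> 'a::locally_convex_t2_space \<Rightarrow> real"
  assumes D: "convex D" and C: "convex C" and z0: "z0 \<in> interior D" "z0 \<in> interior C"
    and a: "a \<in> D" "a \<in> C" and fin: "finite I" "finite J"
    and g: "\<And>i. i \<in> I \<Longrightarrow> convex_on UNIV (g i)" "\<And>i z. i \<in> I \<Longrightarrow> isCont (g i) z"
    and lam: "\<And>i. i \<in> I \<Longrightarrow> lam i \<ge> 0" and A: "A \<subseteq> I" "\<And>i. i \<in> I - A \<Longrightarrow> lam i = 0"
    and p: "\<And>j. j \<in> J \<Longrightarrow> p j \<in> top_dual" and h: "\<And>j. j \<in> J \<Longrightarrow> h j = (\<lambda>z. p j z - b j)"
  shows "subgradients (D \<inter> C) (\<lambda>z. (\<Sum>i\<in>I. lam i * g i z) + (\<Sum>j\<in>J. \<nu> j * h j z)) a =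
    subgradients D (\<lambda>_. 0) a + (\<Sum>i\<in>A. scale_set (lam i) (subgradients UNIV (g i) a))
      + (\<Sum>j\<in>J. scale_set (\<nu> j) (subgradients UNIV (h j) a)) + subgradients C (\<lambda>_. 0) a"
proof -
  let ?G = "\<lambda>z. \<Sum>i\<in>I. lam i * g i z" and ?H = "\<lambda>z. \<Sum>j\<in>J. \<nu> j * h j z"
  have \<nu>h: "(\<lambda>z. \<nu> j * h j z) = (\<lambda>z. \<nu> j * p j z - \<nu> j * b j)" if "j \<in> J" for j
    using h[OF that] by (simp add: right_diff_distrib)
  have \<nu>p: "(\<lambda>z. \<nu> j * p j z) \<in> top_dual" if "j \<in> J" for j
    using top_dual_scale[OF p[OF that]] .
  have conv_h: "convex_on UNIV (\<lambda>z. \<nu> j * h j z)" if "j \<in> J" for j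
    using linear_imp_affine_convex_on(1)[of "\<lambda>z. \<nu> j * p j z" UNIV 0 "- (\<nu> j * b j)"] \<nu>p[OF that]
    by (simp add: \<nu>h[OF that] top_dual_def)
  have cont_h: "isCont (\<lambda>z. \<nu> j * h j z) z" if "j \<in> J" for j z
    using \<nu>p[OF that] unfolding \<nu>h[OF that] top_dual_def
    by (auto intro!: continuous_intros simp: continuous_on_eq_continuous_at)
  have conv_G: "convex_on UNIV ?G"
    using convex_on_weighted_sum[OF fin(1) convex_UNIV lam g(1)] .
  have conv_H: "convex_on UNIV ?H"
    using convex_on_weighted_sum[OF fin(2) convex_UNIV, of "\<lambda>_. 1" "\<lambda>j z. \<nu> j * h j z"] conv_h
    by simp
  have cont_G: "isCont ?G a"
    using g(2) by (intro continuous_intros)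
  have conv_S: "convex_on UNIV (\<lambda>z. ?G z + ?H z)"
    using conv_G conv_H by (rule convex_on_add)
  have SC: "convex_on C (\<lambda>z. ?G z + ?H z)"
    using convex_on_subset[OF conv_S subset_UNIV C] .
  have zero: "convex_on D (\<lambda>_. 0)" "convex_on C (\<lambda>_. 0)"
    using D C by (simp_all add: convex_on_const)
  have "z0 \<in> C"
    using z0(2) interior_subset by blast
  then have "subgradients (D \<inter> C) (\<lambda>z. ?G z + ?H z) a =
      subgradients D (\<lambda>_. 0) a + subgradients C (\<lambda>z. ?G z + ?H z) a"
    using subgradients_sum_rule[OF zero(1) SC z0(1) _ _ a] by simp
  also have "subgradients C (\<lambda>z. ?G z + ?H z) a =
      subgradients C (\<lambda>_. 0) a + subgradients UNIV (\<lambda>z. ?G z + ?H z) a"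
    using subgradients_sum_rule[OF zero(2) conv_S z0(2) _ _ a(2)] by simp
  also have "subgradients UNIV (\<lambda>z. ?G z + ?H z) a = subgradients UNIV ?G a + subgradients UNIV ?H a"
    using subgradients_sum_rule[OF conv_G conv_H, of a a] cont_G by simp
  also have "subgradients UNIV ?G a = (\<Sum>i\<in>I. subgradients UNIV (\<lambda>z. lam i * g i z) a)"
    using fin(1) g lam by (intro subgradients_finite_sum convex_on_cmul continuous_intros)
  also have "\<dots> = (\<Sum>i\<in>I. scale_set (lam i) (subgradients UNIV (g i) a))"
    using g lam by (intro sum.cong refl subgradients_scale)
  also have "\<dots> = (\<Sum>i\<in>A. scale_set (lam i) (subgradients UNIV (g i) a))"
  proof (rule sum.mono_neutral_right[OF fin(1) A(1)], intro ballI)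
    fix i assume i: "i \<in> I - A"
    then have "scale_set (lam i) (subgradients UNIV (g i) a) = subgradients UNIV (\<lambda>z. lam i * g i z) a"
      using g lam by (intro subgradients_scale[symmetric]) auto
    then show "scale_set (lam i) (subgradients UNIV (g i) a) = 0"
      using A(2)[OF i] by (simp add: subgradients_zero_fun)
  qed
  also have "subgradients UNIV ?H a = (\<Sum>j\<in>J. subgradients UNIV (\<lambda>z. \<nu> j * h j z) a)"
    using fin(2) conv_h cont_h by (intro subgradients_finite_sum)
  also have "\<dots> = (\<Sum>j\<in>J. scale_set (\<nu> j) (subgradients UNIV (h j) a))"
  proof (rule sum.cong[OF refl])
    fix j assume j: "j \<in> J"
    have "subgradients UNIV (\<lambda>z. \<nu> j * h j z) a = {\<lambda>z. \<nu> j * p j z}"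
      by (simp only: \<nu>h[OF j] subgradients_affine[OF \<nu>p[OF j]])
    moreover have "subgradients UNIV (h j) a = {p j}"
      by (simp only: h[OF j] subgradients_affine[OF p[OF j]])
    ultimately show "subgradients UNIV (\<lambda>z. \<nu> j * h j z) a = scale_set (\<nu> j) (subgradients UNIV (h j) a)"
      by (simp add: scale_set_def)
  qed
  finally show ?thesis
    by (simp add: ac_simps)
qed

text \<open>Rephrases the projection of the slice \<open>X\<^sup>* \<times> {0}\<close> through the inverse identification, so that
  membership becomes a condition on the single functional \<open>(u, 0)\<close>.\<close>

lemma fst_dual_split_slice:
  fixes A :: "('a::{real_vector,topological_space} \<times> 'b::{real_vector,topological_space} \<Rightarrow> real) set"
  assumes "A \<subseteq> top_dual"
  shows "fst ` (dual_split ` A \<inter> (top_dual \<times> {0})) = {u \<in> top_dual. dual_pair u 0 \<in> A}"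
proof (intro equalityI subsetI)
  fix u assume "u \<in> fst ` (dual_split ` A \<inter> (top_dual \<times> {0}))"
  then obtain q where q: "q \<in> dual_split ` A" "q \<in> top_dual \<times> {0}" "u = fst q"
    by (elim imageE[of u] IntE)
  from q(1) obtain w where w: "w \<in> A" "q = dual_split w"
    by (elim imageE)
  have "linear w"
    using w(1) assms by (auto simp: top_dual_def)
  then have "case_prod dual_pair (dual_split w) = w"
    by (rule dual_pair_split)
  moreover have "dual_split w = (u, 0)" "u \<in> top_dual"
    using q(2,3) unfolding w(2)[symmetric] by (auto simp only: mem_Times_iff prod_eq_iff fst_conv snd_conv singleton_iff)
  ultimately have "dual_pair u 0 = w" "u \<in> top_dual"
    by (simp_all only: prod.case)
  then show "u \<in> {u \<in> top_dual. dual_pair u 0 \<in> A}"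
    using w(1) by (simp only: mem_Collect_eq simp_thms)
next
  fix u assume "u \<in> {u \<in> top_dual. dual_pair u 0 \<in> A}"
  then have u: "u \<in> top_dual" "dual_pair u 0 \<in> A"
    by simp_all
  have "linear u" "linear (0 :: 'b \<Rightarrow> real)"
    using u(1) top_dual_zero unfolding top_dual_def by blast+
  then have "(u, 0) = dual_split (dual_pair u (0 :: 'b \<Rightarrow> real))"
    by (rule dual_split_pair[symmetric])
  then have "(u, 0) \<in> dual_split ` A"
    using u(2) by (rule image_eqI)
  then have "(u, 0) \<in> dual_split ` A \<inter> (top_dual \<times> {0})"
    using u(1) by (intro IntI SigmaI singletonI)
  then show "u \<in> fst ` (dual_split ` A \<inter> (top_dual \<times> {0}))"
    by (rule image_eqI[rotated]) (rule fst_conv[symmetric])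
qed

lemma edom_opt_value:
  "edom (opt_value \<phi> C m g k h) = {x. \<exists>y\<in>feasible C m g k h x. (x, y) \<in> edom \<phi>}"
  by (simp only: edom_def opt_value_def INF_less_iff mem_Collect_eq)

text \<open>A normal \<open>u\<close> to the projection at the first component of \<open>a\<close> says precisely that \<open>a\<close> minimises
  \<open>z \<mapsto> - u (fst z - fst a)\<close> over the part of \<open>D\<close> that satisfies all the constraints, with minimum \<open>0\<close>.  Lagrange
  multipliers turn this into a subgradient \<open>(u, 0)\<close> of the Lagrangian, and the value of that
  inequality at \<open>a\<close> itself gives complementary slackness.\<close>

lemma normal_cone_projection:
  fixes g :: "nat \<Rightarrow> 'x::locally_convex_t2_space \<times> 'y::locally_convex_t2_space \<Rightarrow> real"
  assumes D: "convex D" and C: "convex C" and z0: "z0 \<in> interior D" "z0 \<in> interior C"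
    and a: "a \<in> D" "a \<in> C" "\<And>i. i \<in> {1..m} \<Longrightarrow> g i a \<le> 0" "\<And>j. j \<in> {1..k} \<Longrightarrow> h j a = 0"
    and g: "\<And>i. i \<in> {1..m} \<Longrightarrow> convex_on UNIV (g i)" "\<And>i. i \<in> {1..m} \<Longrightarrow> g i z0 < 0"
    and h: "\<And>j. j \<in> {1..k} \<Longrightarrow> convex_on UNIV (h j)"
      "\<And>j. j \<in> {1..k} \<Longrightarrow> convex_on UNIV (\<lambda>z. - h j z)" "\<And>j. j \<in> {1..k} \<Longrightarrow> h j z0 = 0"
    and u: "u \<in> top_dual"
  shows "u \<in> subgradients {x. \<exists>y\<in>feasible C m g k h x. (x, y) \<in> D} (\<lambda>_. 0) (fst a) \<longleftrightarrow>
    (\<exists>(lam, \<nu>) \<in> Lambda0 m k g a. dual_pair u 0 \<in> subgradients (D \<inter> C)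
      (\<lambda>z. (\<Sum>i\<in>{1..m}. lam i * g i z) + (\<Sum>j\<in>{1..k}. \<nu> j * h j z)) a)"
    (is "?L \<longleftrightarrow> ?R")
proof
  assume ?L
  then have le: "u (fst z - fst a) \<le> 0" if "z \<in> D \<inter> C" "\<And>i. i \<in> {1..m} \<Longrightarrow> g i z \<le> 0"
      "\<And>j. j \<in> {1..k} \<Longrightarrow> h j z = 0" for z
  proof -
    have "snd z \<in> feasible C m g k h (fst z)"
      using that by (simp add: feasible_def)
    then have "fst z \<in> {x. \<exists>y\<in>feasible C m g k h x. (x, y) \<in> D}"
      using that(1) by (auto intro!: bexI[of _ "snd z"])
    then show ?thesis
      using \<open>?L\<close> unfolding subgradients_def by fastforce
  qed
  have lin: "linear (\<lambda>z. u (fst z))"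
    using u linear_compose[OF linear_fst, of u] by (simp add: top_dual_def o_def)
  have DC: "convex (D \<inter> C)"
    using D C by (rule convex_Int)
  have z0': "z0 \<in> interior (D \<inter> C)"
    using z0 by simp
  have f: "convex_on (D \<inter> C) (\<lambda>z. - u (fst (z - a)))"
    using linear_imp_affine_convex_on(2)[OF lin DC, of a 0] by simp
  have rcore: "\<exists>s>0. z0 - s *\<^sub>R (z - z0) \<in> D \<inter> C" if "z \<in> D \<inter> C" for z
    using interior_imp_core[OF z0', of "- (z - z0)"]
    by (simp only: scaleR_minus_right add_uminus_conv_diff)
  have nonneg: "0 \<le> - u (fst (z - a))" if "z \<in> D \<inter> C" "\<And>i. i \<in> {1..m} \<Longrightarrow> g i z \<le> 0"
      "\<And>j. j \<in> {1..k} \<Longrightarrow> h j z = 0" for z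
    using le[OF that] by simp
  have gh: "i \<in> {1..m} \<Longrightarrow> convex_on (D \<inter> C) (g i)" "j \<in> {1..k} \<Longrightarrow> convex_on (D \<inter> C) (h j)"
    "j \<in> {1..k} \<Longrightarrow> convex_on (D \<inter> C) (\<lambda>z. - h j z)" for i j
    using g(1) h(1,2) DC by (blast intro: convex_on_subset)+
  have z0_in: "z0 \<in> D \<inter> C"
    using z0' interior_subset by blast
  obtain lam nu where lam: "\<And>i. i \<in> {1..m} \<Longrightarrow> lam i \<ge> 0"
    and ge: "\<And>z. z \<in> D \<inter> C \<Longrightarrow>
      0 \<le> - u (fst (z - a)) + (\<Sum>i\<in>{1..m}. lam i * g i z) + (\<Sum>j\<in>{1..k}. nu j * h j z)"
    by (rule lagrange_multipliers[where I = "{1..m}" and J = "{1..k}" and g = g and h = h,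
        OF finite_atLeastAtMost finite_atLeastAtMost f gh z0_in rcore g(2) h(3) nonneg]) blast+
  have h0: "(\<Sum>j\<in>{1..k}. \<nu> j * h j a) = 0" for \<nu>
    using a(4) by simp
  have nonpos: "lam i * g i a \<le> 0" if "i \<in> {1..m}" for i
    using lam[OF that] a(3)[OF that] by (rule mult_nonneg_nonpos)
  have "0 \<le> (\<Sum>i\<in>{1..m}. lam i * g i a)"
    using ge[of a] a(1,2) h0 u by (simp add: top_dual_def linear_0)
  then have g0: "(\<Sum>i\<in>{1..m}. lam i * g i a) = 0"
    using sum_nonpos[of "{1..m}" "\<lambda>i. lam i * g i a"] nonpos by force
  have slack: "lam i * g i a = 0" if "i \<in> {1..m}" for i
    using g0 nonpos that sum_nonneg_eq_0_iff[of "{1..m}" "\<lambda>i. - (lam i * g i a)"]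
    by (simp add: sum_negf)
  \<comment> \<open>\<open>Lambda0\<close> consists of extensional functions; the sums see only the values on the index sets.\<close>
  define lam' nu' where "lam' = restrict lam {1..m}" and "nu' = restrict nu {1..k}"
  have eq: "(\<Sum>i\<in>{1..m}. lam' i * g i z) = (\<Sum>i\<in>{1..m}. lam i * g i z)"
    "(\<Sum>j\<in>{1..k}. nu' j * h j z) = (\<Sum>j\<in>{1..k}. nu j * h j z)" for z
    by (auto simp: lam'_def nu'_def)
  have inactive: "lam i = 0" if "i \<in> {1..m} - active m g a" for i
    using slack[of i] that by (auto simp: active_def)
  have "(lam', nu') \<in> Lambda0 m k g a"
    using lam inactive by (simp add: Lambda0_def lam'_def nu'_def)
  moreover have "dual_pair u 0 (z - a) \<le> (\<Sum>i\<in>{1..m}. lam' i * g i z) + (\<Sum>j\<in>{1..k}. nu' j * h j z)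
      - ((\<Sum>i\<in>{1..m}. lam' i * g i a) + (\<Sum>j\<in>{1..k}. nu' j * h j a))" if "z \<in> D \<inter> C" for z
    using ge[OF that] unfolding eq g0 h0 by (simp add: dual_pair_def split_beta)
  then have "dual_pair u 0 \<in> subgradients (D \<inter> C)
      (\<lambda>z. (\<Sum>i\<in>{1..m}. lam' i * g i z) + (\<Sum>j\<in>{1..k}. nu' j * h j z)) a"
    using dual_pair_in_top_dual[OF u top_dual_zero] unfolding subgradients_def by blast
  ultimately show ?R
    by blast
next
  assume ?R
  then obtain lam nu where l: "(lam, nu) \<in> Lambda0 m k g a" and "dual_pair u 0 \<in> subgradients (D \<inter> C)
      (\<lambda>z. (\<Sum>i\<in>{1..m}. lam i * g i z) + (\<Sum>j\<in>{1..k}. nu j * h j z)) a"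
    by blast
  then have le: "u (fst z - fst a) \<le> (\<Sum>i\<in>{1..m}. lam i * g i z) + (\<Sum>j\<in>{1..k}. nu j * h j z)
      - ((\<Sum>i\<in>{1..m}. lam i * g i a) + (\<Sum>j\<in>{1..k}. nu j * h j a))" if "z \<in> D \<inter> C" for z
    using that by (auto simp: subgradients_def dual_pair_def split_beta)
  have "lam i * g i a = 0" if "i \<in> {1..m}" for i
    using l that by (cases "i \<in> active m g a") (auto simp: Lambda0_def active_def)
  then have at_a: "(\<Sum>i\<in>{1..m}. lam i * g i a) = 0" "(\<Sum>j\<in>{1..k}. nu j * h j a) = 0"
    using a(4) by (auto intro!: sum.neutral simp del: mult_eq_0_iff)
  have "u (x - fst a) \<le> 0" if "y \<in> feasible C m g k h x" "(x, y) \<in> D" for x y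
  proof -
    have "(\<Sum>i\<in>{1..m}. lam i * g i (x, y)) \<le> 0"
      using l that(1) by (intro sum_nonpos mult_nonneg_nonpos) (auto simp: Lambda0_def feasible_def)
    moreover have "(\<Sum>j\<in>{1..k}. nu j * h j (x, y)) = 0"
      using that(1) by (simp add: feasible_def)
    ultimately show ?thesis
      using le[of "(x, y)"] at_a that by (simp add: feasible_def)
  qed
  then show ?L
    using u by (auto simp: subgradients_def)
qed

theorem theorem10:
  fixes \<phi> :: "'x::locally_convex_t2_space \<times> 'y::locally_convex_t2_space \<Rightarrow> ereal"
    and g :: "nat \<Rightarrow> 'x \<times> 'y \<Rightarrow> real"
    and h :: "nat \<Rightarrow> 'x \<times> 'y \<Rightarrow> real"
    and C :: "('x \<times> 'y) set"
    and m k :: nat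
    and xs :: "nat \<Rightarrow> 'x \<Rightarrow> real"
    and ys :: "nat \<Rightarrow> 'y \<Rightarrow> real"
    and \<alpha> :: "nat \<Rightarrow> real"
    and xbar x0 :: 'x and y0 :: 'y
  assumes "proper_fun \<phi>" and "convex_fun \<phi>"
    and "\<And>i. i \<in> {1..m} \<Longrightarrow> continuous_on UNIV (g i)"
    and "\<And>i. i \<in> {1..m} \<Longrightarrow> convex_on UNIV (g i)"
    and "convex C"
    and "\<And>j. j \<in> {1..k} \<Longrightarrow> xs j \<in> top_dual"
    and "\<And>j. j \<in> {1..k} \<Longrightarrow> ys j \<in> top_dual"
    and "\<And>j z. j \<in> {1..k} \<Longrightarrow> h j z = dual_pair (xs j) (ys j) z - \<alpha> j"
    and "xbar \<in> edom (opt_value \<phi> C m g k h)"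
    and "solutions \<phi> C m g k h xbar \<noteq> {}"
    and "(x0, y0) \<in> interior C"
    and "finite_continuous_at \<phi> (x0, y0)"
    and "\<And>i. i \<in> {1..m} \<Longrightarrow> g i (x0, y0) < 0"
    and "\<And>j. j \<in> {1..k} \<Longrightarrow> h j (x0, y0) = 0"
  shows "\<forall>ybar \<in> solutions \<phi> C m g k h xbar.
      singular_subdiff (opt_value \<phi> C m g k h) xbar =
        (\<Union>(lam, \<nu>) \<in> Lambda0 m k g (xbar, ybar).
           fst ` (dual_split ` subdiff (Lhat \<phi> C m g k h lam \<nu>) (xbar, ybar) \<inter> (top_dual \<times> {0})))
      \<and> (\<forall>(lam, \<nu>) \<in> Lambda0 m k g (xbar, ybar).
           subdiff (Lhat \<phi> C m g k h lam \<nu>) (xbar, ybar) =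
             singular_subdiff \<phi> (xbar, ybar)
             + (\<Sum>i \<in> active m g (xbar, ybar).
                  scale_set (lam i) (subdiff (\<lambda>z. ereal (g i z)) (xbar, ybar)))
             + (\<Sum>j \<in> {1..k}. scale_set (\<nu> j) (subdiff (\<lambda>z. ereal (h j z)) (xbar, ybar)))
             + normal_cone (xbar, ybar) C)"
proof (intro ballI conjI)
  let ?\<mu> = "opt_value \<phi> C m g k h" and ?D = "edom \<phi>"
  fix ybar assume ybar: "ybar \<in> solutions \<phi> C m g k h xbar"
  let ?a = "(xbar, ybar)"
  have feas: "ybar \<in> feasible C m g k h xbar" and val: "?\<mu> xbar = \<phi> ?a"
    using ybar by (auto simp: solutions_def)
  have fin: "\<bar>\<phi> ?a\<bar> \<noteq> \<infinity>"
    using assms(1,9) val by (auto simp: proper_fun_def edom_def)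
  have a: "?a \<in> ?D" "?a \<in> C" "\<And>i. i \<in> {1..m} \<Longrightarrow> g i ?a \<le> 0" "\<And>j. j \<in> {1..k} \<Longrightarrow> h j ?a = 0"
    using feas assms(9) val by (auto simp: feasible_def edom_def)
  have D: "convex ?D" and z0: "(x0, y0) \<in> interior ?D"
    using convex_edom[OF assms(2)] finite_continuous_interior_edom[OF assms(12)] .
  define p where "p j = dual_pair (xs j) (ys j)" for j
  have p: "p j \<in> top_dual" if "j \<in> {1..k}" for j
    unfolding p_def using assms(6,7)[OF that] by (rule dual_pair_in_top_dual)
  have h: "h j = (\<lambda>z. p j z - \<alpha> j)" if "j \<in> {1..k}" for j
    using assms(8)[OF that] by (auto simp: p_def)
  have h_conv: "convex_on UNIV (h j)" "convex_on UNIV (\<lambda>z. - h j z)" if "j \<in> {1..k}" for j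
    using linear_imp_affine_convex_on(1)[of "p j" UNIV 0 "- \<alpha> j"]
      linear_imp_affine_convex_on(2)[of "p j" UNIV 0 "\<alpha> j"] p[OF that] h[OF that]
    by (simp_all add: top_dual_def)
  have g_cont: "isCont (g i) z" if "i \<in> {1..m}" for i z
    using assms(3)[OF that] by (metis UNIV_I continuous_on_eq_continuous_at open_UNIV)
  let ?S = "\<lambda>lam \<nu>. subgradients (?D \<inter> C)
      (\<lambda>z. (\<Sum>i\<in>{1..m}. lam i * g i z) + (\<Sum>j\<in>{1..k}. \<nu> j * h j z)) ?a"
  have L: "subdiff (Lhat \<phi> C m g k h lam \<nu>) ?a = ?S lam \<nu>" for lam \<nu>
    using a(1,2) by (rule subdiff_Lhat)
  have slice: "fst ` (dual_split ` ?S lam \<nu> \<inter> (top_dual \<times> {0})) = {u \<in> top_dual. dual_pair u 0 \<in> ?S lam \<nu>}"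
    for lam \<nu>
    by (rule fst_dual_split_slice) (auto simp: subgradients_def)
  have member: "u \<in> subgradients (edom ?\<mu>) (\<lambda>_. 0) xbar \<longleftrightarrow>
      (\<exists>(lam, \<nu>) \<in> Lambda0 m k g ?a. dual_pair u 0 \<in> ?S lam \<nu>)" if "u \<in> top_dual" for u
    using normal_cone_projection[where m = m and k = k and g = g and h = h,
        OF D assms(5) z0 assms(11) a assms(4,13) h_conv assms(14) that]
    unfolding edom_opt_value fst_conv .
  have "singular_subdiff ?\<mu> xbar = subgradients (edom ?\<mu>) (\<lambda>_. 0) xbar"
    using fin val by (intro singular_subdiff_eq) simp
  also have "\<dots> = {u \<in> top_dual. \<exists>(lam, \<nu>) \<in> Lambda0 m k g ?a. dual_pair u 0 \<in> ?S lam \<nu>}"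
  proof (intro equalityI subsetI)
    fix u assume u: "u \<in> subgradients (edom ?\<mu>) (\<lambda>_. 0) xbar"
    then have "u \<in> top_dual"
      by (simp add: subgradients_def)
    then show "u \<in> {u \<in> top_dual. \<exists>(lam, \<nu>) \<in> Lambda0 m k g ?a. dual_pair u 0 \<in> ?S lam \<nu>}"
      using u member by simp
  qed (use member in simp)
  finally show "singular_subdiff ?\<mu> xbar = (\<Union>(lam, \<nu>) \<in> Lambda0 m k g ?a.
      fst ` (dual_split ` subdiff (Lhat \<phi> C m g k h lam \<nu>) ?a \<inter> (top_dual \<times> {0})))"
    unfolding L slice by blast
  fix l assume "l \<in> Lambda0 m k g ?a"
  then obtain lam \<nu> where l: "l = (lam, \<nu>)" and lam: "\<And>i. i \<in> {1..m} \<Longrightarrow> lam i \<ge> 0"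
      "\<And>i. i \<in> {1..m} - active m g ?a \<Longrightarrow> lam i = 0"
    by (auto simp: Lambda0_def)
  have "active m g ?a \<subseteq> {1..m}"
    by (auto simp: active_def)
  then show "case l of (lam, \<nu>) \<Rightarrow> subdiff (Lhat \<phi> C m g k h lam \<nu>) ?a =
      singular_subdiff \<phi> ?a
      + (\<Sum>i \<in> active m g ?a. scale_set (lam i) (subdiff (\<lambda>z. ereal (g i z)) ?a))
      + (\<Sum>j \<in> {1..k}. scale_set (\<nu> j) (subdiff (\<lambda>z. ereal (h j z)) ?a))
      + normal_cone ?a C"
    unfolding l prod.case L subdiff_real normal_cone_eq singular_subdiff_eq[where f = \<phi>, OF fin]
    using lam p h g_cont assms(4) by (intro subgradients_lagrangian[OF D assms(5) z0 assms(11) a(1,2)]) auto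
qed

end
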